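(* There is an algorithm that, given a graph $G$ with $n$ vertices, computes the linear boolean-width $\operatorname{lbw}(G)$ in $O(n\cdot 2^{n+\operatorname{lbw}(G)})$ time using $O(n\cdot 2^n)$ space.
   Context: Let $G=(V,E)$ be a finite simple undirected graph. For $A\subseteq V$ write $\overline{A}=V\setminus A$ and $N(X)=\bigcup_{x\in X}N(x)$. Define $\mathcal{UN}(A)=\{N(X)\cap\overline{A}: X\subseteq A\}$ and $\operatorname{booldim}(A)=\log_2|\mathcal{UN}(A)|$. A decomposition tree of $G$ is a pair $(T,\delta)$ with $T$ a full binary tree and $\delta$ a bijection from the leaves of $T$ to $V$; for a node $w$, $\delta(w)$ is the set of vertices at leaves below $w$. Its boolean-width is $\max_{w\in T}\operatorname{booldim}(\delta(w))$. A linear decomposition is a decomposition tree in which every internal node has at least one leaf as a child; $\operatorname{lbw}(G)$ is the minimum boolean-width over all linear decompositions of $G$. Computational model: subsets of $V$ are represented as bitsets, and each set operation takes $O(n)$ time and $O(n)$ space. *)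

theory Defs
  imports Complex_Main "HOL-Library.Nat_Bijection" "Graph_Theory.Pair_Digraph"
begin

section \<open>Linear boolean-width\<close>

text \<open>
  Finite simple undirected graphs are the finite, symmetric, loop-free digraphs without parallel
  arcs, \<^locale>\<open>pair_graph\<close>.
\<close>

definition neighbours :: "'a pair_pre_digraph \<Rightarrow> 'a \<Rightarrow> 'a set" where
  "neighbours G x = {y. (x, y) \<in> parcs G}"

definition Neighbours :: "'a pair_pre_digraph \<Rightarrow> 'a set \<Rightarrow> 'a set" where
  "Neighbours G X = (\<Union>x\<in>X. neighbours G x)"

definition union_nbhds :: "'a pair_pre_digraph \<Rightarrow> 'a set \<Rightarrow> 'a set set" where
  "union_nbhds G A = {Neighbours G X \<inter> (pverts G - A) | X. X \<subseteq> A}"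

definition booldim :: "'a pair_pre_digraph \<Rightarrow> 'a set \<Rightarrow> real" where
  "booldim G A = log 2 (real (card (union_nbhds G A)))"

text \<open>
  A decomposition tree \<open>(T, \<delta>)\<close> is a full binary tree whose leaves are labelled with their
  \<open>\<delta>\<close>-images.  Nodes are identified with the subtrees they root (distinct nodes of a decomposition
  tree root distinct subtrees, the leaf labels being distinct), and \<open>\<delta> w\<close> is \<open>set (leaves w)\<close>.
\<close>

datatype 'a dtree = Leaf 'a | Node "'a dtree" "'a dtree"

primrec leaves :: "'a dtree \<Rightarrow> 'a list" where
  "leaves (Leaf v) = [v]"
| "leaves (Node l r) = leaves l @ leaves r"

primrec nodes :: "'a dtree \<Rightarrow> 'a dtree set" where
  "nodes (Leaf v) = {Leaf v}"
| "nodes (Node l r) = insert (Node l r) (nodes l \<union> nodes r)"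

definition decomposition_tree :: "'a pair_pre_digraph \<Rightarrow> 'a dtree \<Rightarrow> bool" where
  "decomposition_tree G T \<longleftrightarrow> distinct (leaves T) \<and> set (leaves T) = pverts G"

definition boolean_width :: "'a pair_pre_digraph \<Rightarrow> 'a dtree \<Rightarrow> real" where
  "boolean_width G T = Max ((\<lambda>w. booldim G (set (leaves w))) ` nodes T)"

definition linear_decomposition :: "'a pair_pre_digraph \<Rightarrow> 'a dtree \<Rightarrow> bool" where
  "linear_decomposition G T \<longleftrightarrow> decomposition_tree G T \<and>
     (\<forall>l r. Node l r \<in> nodes T \<longrightarrow> (\<exists>v. l = Leaf v) \<or> (\<exists>v. r = Leaf v))"

definition lbw :: "'a pair_pre_digraph \<Rightarrow> real" where
  "lbw G = Min {boolean_width G T | T. linear_decomposition G T}"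

text \<open>The minimum is over a finite set, and over a nonempty one if the graph has a vertex.\<close>

lemma finite_nodes: "finite (nodes T)"
  by (induction T) auto

lemma nodes_nonempty: "nodes T \<noteq> {}"
  by (cases T) auto

lemma leaves_nodes: "w \<in> nodes T \<Longrightarrow> set (leaves w) \<subseteq> set (leaves T)"
  by (induction T) auto

lemma finite_linear_widths:
  assumes "finite (pverts G)"
  shows "finite {boolean_width G T | T. linear_decomposition G T}"
proof (rule finite_subset)
  show "{boolean_width G T | T. linear_decomposition G T} \<subseteq> booldim G ` Pow (pverts G)"
  proof clarify
    fix T assume "linear_decomposition G T"
    then have "set (leaves T) = pverts G"
      by (simp add: linear_decomposition_def decomposition_tree_def)
    moreover have "boolean_width G T \<in> (\<lambda>w. booldim G (set (leaves w))) ` nodes T"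
      unfolding boolean_width_def by (rule Max_in) (simp_all add: finite_nodes nodes_nonempty)
    ultimately show "boolean_width G T \<in> booldim G ` Pow (pverts G)"
      using leaves_nodes by blast
  qed
qed (use assms in simp)

lemma linear_decomposition_exists:
  assumes "finite (pverts G)" "pverts G \<noteq> {}"
  shows "\<exists>T. linear_decomposition G T"
proof -
  have "\<exists>T. distinct (leaves T) \<and> set (leaves T) = A \<and>
          (\<forall>l r. Node l r \<in> nodes T \<longrightarrow> (\<exists>v. l = Leaf v) \<or> (\<exists>v. r = Leaf v))"
    if "finite A" "A \<noteq> {}" for A :: "'a set"
    using that
  proof (induction A rule: finite_ne_induct)
    case (singleton x)
    show ?case by (rule exI[of _ "Leaf x"]) auto
  next
    case (insert x F)
    then obtain T where "distinct (leaves T)" "set (leaves T) = F"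
      "\<forall>l r. Node l r \<in> nodes T \<longrightarrow> (\<exists>v. l = Leaf v) \<or> (\<exists>v. r = Leaf v)"
      by blast
    with insert.hyps show ?case by (intro exI[of _ "Node (Leaf x) T"]) auto
  qed
  from this[OF assms] show ?thesis
    by (simp add: linear_decomposition_def decomposition_tree_def)
qed


section \<open>The computational model\<close>

text \<open>
  A random access machine with two kinds of data: natural numbers stored in machine words, and
  subsets of the vertex set \<open>{..<n}\<close> stored as bitsets of length \<open>n\<close>.  An operation on words takes
  one unit of time and an operation on bitsets takes \<open>n\<close> units; a word occupies
  \<open>word_size\<close> units (bits) of space and a bitset occupies \<open>n\<close> units.

  Both kinds of data live in registers named by \<open>'v\<close> and in random access memory.  A program is a
  term of type \<open>'v com\<close>, so it is fixed independently of the input and mentions only finitely many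
  registers.  \<open>Index S\<close> reads the bitset \<open>S\<close> as the binary number \<open>\<Sum>i\<in>S. 2 ^ i\<close>, which allows
  tables to be indexed by vertex sets.
\<close>

datatype (iexp_vars: 'v) iexp =
    Const nat
  | IReg 'v
  | ILoad "'v iexp"
  | Plus "'v iexp" "'v iexp"
  | Minus "'v iexp" "'v iexp"
  | Index "'v sexp"
and (sexp_vars: 'v) sexp =
    SEmpty
  | SReg 'v
  | SLoad "'v iexp"
  | SSingleton "'v iexp"
  | SUnion "'v sexp" "'v sexp"
  | SInter "'v sexp" "'v sexp"
  | SDiff "'v sexp" "'v sexp"

datatype (bexp_vars: 'v) bexp =
    Less "'v iexp" "'v iexp"
  | IEq "'v iexp" "'v iexp"
  | Member "'v iexp" "'v sexp"
  | SEq "'v sexp" "'v sexp"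
  | BNot "'v bexp"
  | BAnd "'v bexp" "'v bexp"

datatype (vars: 'v) com =
    Skip
  | IAssign 'v "'v iexp"
  | SAssign 'v "'v sexp"
  | IStore "'v iexp" "'v iexp"
  | SStore "'v iexp" "'v sexp"
  | Seq "'v com" "'v com"
  | Cond "'v bexp" "'v com" "'v com"
  | While "'v bexp" "'v com"

record 'v state =
  ireg :: "'v \<Rightarrow> nat"
  sreg :: "'v \<Rightarrow> nat set"
  imem :: "nat \<Rightarrow> nat"
  smem :: "nat \<Rightarrow> nat set"

primrec ival :: "'v state \<Rightarrow> 'v iexp \<Rightarrow> nat" and sval :: "'v state \<Rightarrow> 'v sexp \<Rightarrow> nat set" where
  "ival s (Const k) = k"
| "ival s (IReg x) = ireg s x"
| "ival s (ILoad a) = imem s (ival s a)"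
| "ival s (Plus a b) = ival s a + ival s b"
| "ival s (Minus a b) = ival s a - ival s b"
| "ival s (Index A) = set_encode (sval s A)"
| "sval s SEmpty = {}"
| "sval s (SReg x) = sreg s x"
| "sval s (SLoad a) = smem s (ival s a)"
| "sval s (SSingleton a) = {ival s a}"
| "sval s (SUnion A B) = sval s A \<union> sval s B"
| "sval s (SInter A B) = sval s A \<inter> sval s B"
| "sval s (SDiff A B) = sval s A - sval s B"

primrec bval :: "'v state \<Rightarrow> 'v bexp \<Rightarrow> bool" where
  "bval s (Less a b) \<longleftrightarrow> ival s a < ival s b"
| "bval s (IEq a b) \<longleftrightarrow> ival s a = ival s b"
| "bval s (Member a A) \<longleftrightarrow> ival s a \<in> sval s A"
| "bval s (SEq A B) \<longleftrightarrow> sval s A = sval s B"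
| "bval s (BNot b) \<longleftrightarrow> \<not> bval s b"
| "bval s (BAnd b c) \<longleftrightarrow> bval s b \<and> bval s c"

primrec icost :: "nat \<Rightarrow> 'v iexp \<Rightarrow> nat" and scost :: "nat \<Rightarrow> 'v sexp \<Rightarrow> nat" where
  "icost n (Const k) = 1"
| "icost n (IReg x) = 1"
| "icost n (ILoad a) = icost n a + 1"
| "icost n (Plus a b) = icost n a + icost n b + 1"
| "icost n (Minus a b) = icost n a + icost n b + 1"
| "icost n (Index A) = scost n A + n"
| "scost n SEmpty = n"
| "scost n (SReg x) = n"
| "scost n (SLoad a) = icost n a + n"
| "scost n (SSingleton a) = icost n a + n"
| "scost n (SUnion A B) = scost n A + scost n B + n"
| "scost n (SInter A B) = scost n A + scost n B + n"
| "scost n (SDiff A B) = scost n A + scost n B + n"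

primrec bcost :: "nat \<Rightarrow> 'v bexp \<Rightarrow> nat" where
  "bcost n (Less a b) = icost n a + icost n b + 1"
| "bcost n (IEq a b) = icost n a + icost n b + 1"
| "bcost n (Member a A) = icost n a + scost n A + n"
| "bcost n (SEq A B) = scost n A + scost n B + n"
| "bcost n (BNot b) = bcost n b + 1"
| "bcost n (BAnd b c) = bcost n b + bcost n c + 1"

text \<open>
  A machine has words of \<open>word_size\<close> bits, bitsets of length \<open>set_size\<close>, and \<open>icells\<close> and
  \<open>scells\<close> memory cells for words and for bitsets.  The predicates below require that evaluation
  does not overflow a word or a bitset and does not access memory that is not there.
\<close>

record machine =
  set_size :: nat
  word_size :: nat
  icells :: nat
  scells :: nat

primrec ifits :: "machine \<Rightarrow> 'v state \<Rightarrow> 'v iexp \<Rightarrow> bool"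
  and sfits :: "machine \<Rightarrow> 'v state \<Rightarrow> 'v sexp \<Rightarrow> bool" where
  "ifits M s (Const k) \<longleftrightarrow> k < 2 ^ word_size M"
| "ifits M s (IReg x) \<longleftrightarrow> ireg s x < 2 ^ word_size M"
| "ifits M s (ILoad a) \<longleftrightarrow> ifits M s a \<and> ival s a < icells M \<and> imem s (ival s a) < 2 ^ word_size M"
| "ifits M s (Plus a b) \<longleftrightarrow> ifits M s a \<and> ifits M s b \<and> ival s a + ival s b < 2 ^ word_size M"
| "ifits M s (Minus a b) \<longleftrightarrow> ifits M s a \<and> ifits M s b"
| "ifits M s (Index A) \<longleftrightarrow> sfits M s A \<and> set_encode (sval s A) < 2 ^ word_size M"
| "sfits M s SEmpty \<longleftrightarrow> True"
| "sfits M s (SReg x) \<longleftrightarrow> sreg s x \<subseteq> {..<set_size M}"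
| "sfits M s (SLoad a) \<longleftrightarrow>
     ifits M s a \<and> ival s a < scells M \<and> smem s (ival s a) \<subseteq> {..<set_size M}"
| "sfits M s (SSingleton a) \<longleftrightarrow> ifits M s a \<and> ival s a < set_size M"
| "sfits M s (SUnion A B) \<longleftrightarrow> sfits M s A \<and> sfits M s B"
| "sfits M s (SInter A B) \<longleftrightarrow> sfits M s A \<and> sfits M s B"
| "sfits M s (SDiff A B) \<longleftrightarrow> sfits M s A \<and> sfits M s B"

primrec bfits :: "machine \<Rightarrow> 'v state \<Rightarrow> 'v bexp \<Rightarrow> bool" where
  "bfits M s (Less a b) \<longleftrightarrow> ifits M s a \<and> ifits M s b"
| "bfits M s (IEq a b) \<longleftrightarrow> ifits M s a \<and> ifits M s b"
| "bfits M s (Member a A) \<longleftrightarrow> ifits M s a \<and> sfits M s A"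
| "bfits M s (SEq A B) \<longleftrightarrow> sfits M s A \<and> sfits M s B"
| "bfits M s (BNot b) \<longleftrightarrow> bfits M s b"
| "bfits M s (BAnd b c) \<longleftrightarrow> bfits M s b \<and> bfits M s c"

text \<open>
  \<open>exec M c s t s'\<close>: on the machine \<open>M\<close>, the program \<open>c\<close> started in state \<open>s\<close> halts in state \<open>s'\<close>
  after \<open>t\<close> units of time.  A computation exceeding the resources of \<open>M\<close> has no derivation.
\<close>

inductive exec :: "machine \<Rightarrow> 'v com \<Rightarrow> 'v state \<Rightarrow> nat \<Rightarrow> 'v state \<Rightarrow> bool" for M where
  Skip: "exec M Skip s 1 s"
| IAssign: "ifits M s a \<Longrightarrow>
    exec M (IAssign x a) s (icost (set_size M) a + 1) (s\<lparr>ireg := (ireg s)(x := ival s a)\<rparr>)"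
| SAssign: "sfits M s A \<Longrightarrow>
    exec M (SAssign x A) s (scost (set_size M) A + set_size M)
      (s\<lparr>sreg := (sreg s)(x := sval s A)\<rparr>)"
| IStore: "ifits M s a \<Longrightarrow> ival s a < icells M \<Longrightarrow> ifits M s b \<Longrightarrow>
    exec M (IStore a b) s (icost (set_size M) a + icost (set_size M) b + 1)
      (s\<lparr>imem := (imem s)(ival s a := ival s b)\<rparr>)"
| SStore: "ifits M s a \<Longrightarrow> ival s a < scells M \<Longrightarrow> sfits M s A \<Longrightarrow>
    exec M (SStore a A) s (icost (set_size M) a + scost (set_size M) A + set_size M)
      (s\<lparr>smem := (smem s)(ival s a := sval s A)\<rparr>)"
| Seq: "exec M c s t s' \<Longrightarrow> exec M d s' t' s'' \<Longrightarrow> exec M (Seq c d) s (t + t') s''"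
| CondTrue: "bfits M s b \<Longrightarrow> bval s b \<Longrightarrow> exec M c s t s' \<Longrightarrow>
    exec M (Cond b c d) s (bcost (set_size M) b + t + 1) s'"
| CondFalse: "bfits M s b \<Longrightarrow> \<not> bval s b \<Longrightarrow> exec M d s t s' \<Longrightarrow>
    exec M (Cond b c d) s (bcost (set_size M) b + t + 1) s'"
| WhileFalse: "bfits M s b \<Longrightarrow> \<not> bval s b \<Longrightarrow>
    exec M (While b c) s (bcost (set_size M) b + 1) s"
| WhileTrue: "bfits M s b \<Longrightarrow> bval s b \<Longrightarrow> exec M c s t s' \<Longrightarrow> exec M (While b c) s' t' s'' \<Longrightarrow>
    exec M (While b c) s (bcost (set_size M) b + t + t' + 1) s''"

lemma exec_deterministic:
  "exec M c s t s' \<Longrightarrow> exec M c s u s'' \<Longrightarrow> u = t \<and> s'' = s'"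
proof (induction arbitrary: u s'' rule: exec.induct)
  case (Seq c s t s' d t' s2)
  from Seq.prems Seq.IH show ?case by (cases rule: exec.cases) blast+
next
  case (CondTrue s b c t s' d)
  from CondTrue.prems CondTrue.hyps CondTrue.IH show ?case by (cases rule: exec.cases) blast+
next
  case (CondFalse s b d t s' c)
  from CondFalse.prems CondFalse.hyps CondFalse.IH show ?case by (cases rule: exec.cases) blast+
next
  case (WhileTrue s b c t s' t' s2)
  from WhileTrue.prems WhileTrue.hyps WhileTrue.IH show ?case by (cases rule: exec.cases) blast+
qed (erule exec.cases; simp)+

text \<open>
  The space of a machine running \<open>c\<close>: its memory, and a word register and a bitset register for
  every register name in \<open>c\<close>.
\<close>

definition space :: "machine \<Rightarrow> 'v com \<Rightarrow> nat" where
  "space M c = word_size M * (icells M + card (vars c)) + set_size M * (scells M + card (vars c))"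

text \<open>
  A graph with vertex set \<open>{..<n}\<close> is given by \<open>n\<close>, in the word register \<open>''n''\<close>, and the bitsets of
  the neighbourhoods of its vertices, in the first \<open>n\<close> bitset cells of the memory.
\<close>

definition input :: "nat pair_pre_digraph \<Rightarrow> nat \<Rightarrow> string state" where
  "input G n =
     \<lparr>ireg = (\<lambda>_. 0)(''n'' := n), sreg = \<lambda>_. {},
      imem = \<lambda>_. 0, smem = \<lambda>v. if v < n then neighbours G v else {}\<rparr>"

text \<open>
  The real number \<open>lbw G\<close> is the binary logarithm of a positive integer.  A program outputs it by
  leaving that integer in the word register \<open>''out''\<close>.
\<close>

definition outputs_log :: "string state \<Rightarrow> real \<Rightarrow> bool" where
  "outputs_log s x \<longleftrightarrow> ireg s ''out'' > 0 \<and> log 2 (real (ireg s ''out'')) = x"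

end

theory Submission
  imports Defs
begin

text \<open>
  A linear decomposition is an ordering of the vertices, and its width is the largest number of unions
  of neighbourhoods over the initial segments of the ordering; thus \<open>2\<close> to the power of the width is
  the bottleneck value of a path from the empty set to the vertex set in the lattice of vertex sets.
  For a threshold \<open>T\<close>, a depth-first search visits the sets reachable through sets with at most \<open>T\<close>
  unions of neighbourhoods.  The list of unions of neighbourhoods of \<open>insert v A\<close> is computed from the
  list of \<open>A\<close> in time \<open>O(n T)\<close>, and only when \<open>insert v A\<close> is met for the first time.  Trying the
  thresholds \<open>1, 3, 7, \<dots>\<close> until the vertex set is reached gives a geometric sum dominated by
  \<open>n * 2 ^ n\<close> times the bottleneck value, which a dynamic program over the visited sets then
  determines.  The lists on the search stack have lengths at most \<open>2 ^ n, 2 ^ (n - 1), \<dots>\<close>,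
  so \<open>2 * 2 ^ n\<close> bitsets suffice for them.
\<close>

section \<open>Linear boolean-width as a bottleneck path problem\<close>

text \<open>Two resources shape the algorithm. The values \<open>cut_card G A\<close> of arbitrary
  sets may far exceed 2 to the power of the width, so computing the lists of all sets would break
  the time bound. A list is therefore computed only from a parent with at most \<open>T\<close>
  unions, which keeps its cost at O(n T) even if the result is longer than \<open>T\<close>. Keeping
  the lists of all visited sets would break the space bound; a depth-first search needs only those
  on the stack, and every other set is represented by a single number in a table. A new round is
  entered only if the old threshold is below the bottleneck value, so every threshold used is less
  than twice that value, and a round charges O(n T) to each of at most 2^n sets. Doubling alone
  would determine the value only up to a factor of two; the exact value comes from the recurrence
  \<open>reach_iff\<close>, evaluated on the table that the last round leaves.\<close>

definition cut_card :: "'a pair_pre_digraph \<Rightarrow> 'a set \<Rightarrow> nat" where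
  "cut_card G A = card (union_nbhds G A)"

text \<open>A chain that adds one vertex at a time and never exceeds the cut value \<open>k\<close>.
  The premise \<open>1 \<le> k\<close> is this condition for the empty set, whose cut value is
  1.\<close>

inductive reach :: "'a pair_pre_digraph \<Rightarrow> nat \<Rightarrow> 'a set \<Rightarrow> bool" for G k where
  empty: "1 \<le> k \<Longrightarrow> reach G k {}"
| insert: "reach G k A \<Longrightarrow> v \<in> pverts G \<Longrightarrow> v \<notin> A \<Longrightarrow> cut_card G (insert v A) \<le> k
    \<Longrightarrow> reach G k (insert v A)"

text \<open>The minimax value over all such chains to \<open>A\<close>.\<close>

definition bottleneck :: "'a pair_pre_digraph \<Rightarrow> 'a set \<Rightarrow> nat" where
  "bottleneck G A = (LEAST k. reach G k A)"

lemma reach_mono: "reach G k A \<Longrightarrow> k \<le> l \<Longrightarrow> reach G l A"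
  by (induction rule: reach.induct) (auto intro: reach.intros)

lemma reach_pos: "reach G k A \<Longrightarrow> 1 \<le> k"
  by (induction rule: reach.induct) auto

lemma reach_finite: "reach G k A \<Longrightarrow> finite A"
  by (induction rule: reach.induct) auto

lemma reach_subset: "reach G k A \<Longrightarrow> A \<subseteq> pverts G"
  by (induction rule: reach.induct) auto

lemma union_nbhds_image:
  "union_nbhds G A = (\<lambda>X. Neighbours G X \<inter> (pverts G - A)) ` Pow A"
  by (auto simp: union_nbhds_def)

lemma union_nbhds_finite: "finite A \<Longrightarrow> finite (union_nbhds G A)"
  by (simp add: union_nbhds_image)

lemma union_nbhds_empty: "union_nbhds G {} = {{}}"
  by (auto simp: union_nbhds_def Neighbours_def)

lemma empty_in_union_nbhds: "{} \<in> union_nbhds G A"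
  by (auto simp: union_nbhds_def Neighbours_def intro: exI[of _ "{}"])

lemma cut_card_empty [simp]: "cut_card G {} = 1"
  by (simp add: cut_card_def union_nbhds_empty)

lemma cut_card_pos: "finite A \<Longrightarrow> 1 \<le> cut_card G A"
  using empty_in_union_nbhds[of G A] union_nbhds_finite[of A G]
  by (auto simp: cut_card_def Suc_le_eq card_gt_0_iff)

lemma cut_card_le_inside: "finite A \<Longrightarrow> cut_card G A \<le> 2 ^ card A"
  unfolding cut_card_def union_nbhds_image
  by (metis card_Pow card_image_le finite_Pow_iff)

text \<open>Only subsets of the complement can occur. This bound, which shrinks as the set grows,
  dictates the capacities of the list slots in memory.\<close>

lemma cut_card_le_outside:
  assumes "finite (pverts G)" "A \<subseteq> pverts G"
  shows "cut_card G A \<le> 2 ^ (card (pverts G) - card A)"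
proof -
  have "union_nbhds G A \<subseteq> Pow (pverts G - A)" by (auto simp: union_nbhds_def)
  then have "cut_card G A \<le> card (Pow (pverts G - A))"
    unfolding cut_card_def using assms by (intro card_mono) auto
  also have "\<dots> = 2 ^ (card (pverts G) - card A)"
    using assms by (simp add: card_Pow card_Diff_subset finite_subset)
  finally show ?thesis .
qed

text \<open>The recurrence behind the dynamic program: the last step of a chain to \<open>A\<close>
  adds some \<open>v\<close> to \<open>A - {v}\<close>.\<close>

lemma reach_iff:
  assumes "A \<subseteq> pverts G" "A \<noteq> {}"
  shows "reach G k A \<longleftrightarrow> cut_card G A \<le> k \<and> (\<exists>v\<in>A. reach G k (A - {v}))"
proof
  assume "reach G k A"
  then show "cut_card G A \<le> k \<and> (\<exists>v\<in>A. reach G k (A - {v}))"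
  proof cases
    case empty
    then show ?thesis using assms by simp
  next
    case (insert B v)
    then have "A - {v} = B" by auto
    with insert show ?thesis by auto
  qed
next
  assume *: "cut_card G A \<le> k \<and> (\<exists>v\<in>A. reach G k (A - {v}))"
  then obtain v where "v \<in> A" "reach G k (A - {v})" by blast
  with * assms(1) reach.insert[of G k "A - {v}" v] show "reach G k A"
    by (auto simp: insert_absorb)
qed

text \<open>By the bound through the complement, every order of insertion is admissible at this
  threshold. It makes the \<open>LEAST\<close> in \<open>bottleneck\<close> meaningful.\<close>

lemma reach_large:
  assumes "finite (pverts G)" "A \<subseteq> pverts G"
  shows "reach G (2 ^ card (pverts G)) A"
proof -
  have "finite A" using assms finite_subset by blast
  then show ?thesis using assms(2)
  proof induction
    case empty
    show ?case by (simp add: reach.empty)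
  next
    case (insert v A)
    have "cut_card G (insert v A) \<le> 2 ^ (card (pverts G) - card (insert v A))"
      using cut_card_le_outside assms insert by blast
    also have "\<dots> \<le> 2 ^ card (pverts G)" by simp
    finally show ?case using insert by (auto intro: reach.insert)
  qed
qed

lemma bottleneck_le_iff:
  assumes "finite (pverts G)" "A \<subseteq> pverts G"
  shows "bottleneck G A \<le> k \<longleftrightarrow> reach G k A"
proof
  have "reach G (bottleneck G A) A"
    unfolding bottleneck_def by (rule LeastI[of _ "2 ^ card (pverts G)"]) (rule reach_large[OF assms])
  then show "reach G k A" if "bottleneck G A \<le> k" using that reach_mono by blast
  show "bottleneck G A \<le> k" if "reach G k A"
    unfolding bottleneck_def using that by (rule Least_le)
qed

lemma bottleneck_pos:
  assumes "finite (pverts G)" "A \<subseteq> pverts G"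
  shows "1 \<le> bottleneck G A"
  using bottleneck_le_iff[OF assms, of "bottleneck G A"] reach_pos by auto

lemma bottleneck_le_pow:
  assumes "finite (pverts G)" "A \<subseteq> pverts G"
  shows "bottleneck G A \<le> 2 ^ card (pverts G)"
  using bottleneck_le_iff[OF assms] reach_large[OF assms] by blast

section \<open>Linear decompositions versus chains of vertex sets\<close>

lemma linear_tree_reach:
  assumes "distinct (leaves T)" "set (leaves T) \<subseteq> pverts G" "1 \<le> k"
    and "\<forall>l r. Node l r \<in> nodes T \<longrightarrow> (\<exists>v. l = Leaf v) \<or> (\<exists>v. r = Leaf v)"
    and "\<forall>w\<in>nodes T. cut_card G (set (leaves w)) \<le> k"
  shows "reach G k (set (leaves T))"
  using assms
proof (induction T)
  case (Leaf v)
  then show ?case using reach.insert[OF reach.empty, of k v G] by simp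
next
  case (Node l r)
  \<comment> \<open>Whichever child is the leaf, its vertex is the one that the chain adds
    last.\<close>
  then have "(\<exists>v. l = Leaf v) \<or> (\<exists>v. r = Leaf v)" by auto
  then show ?case
  proof (elim disjE exE)
    fix v assume v: "l = Leaf v"
    then have "reach G k (set (leaves r))" using Node by auto
    then show ?thesis using Node.prems v by (auto intro!: reach.insert)
  next
    fix v assume v: "r = Leaf v"
    then have "reach G k (set (leaves l))" using Node by auto
    then show ?thesis using Node.prems v by (auto intro!: reach.insert)
  qed
qed

context pair_graph
begin

text \<open>The crossing arc makes the neighbourhood of \<open>x\<close> contribute a nonempty set
  besides the empty union.\<close>

lemma cut_card_ge_2:
  assumes "finite A" "x \<in> A" "y \<notin> A" "(x, y) \<in> parcs G"
  shows "2 \<le> cut_card G A"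
proof -
  let ?S = "neighbours G x \<inter> (pverts G - A)"
  have "?S \<in> union_nbhds G A"
    using assms(2) by (auto simp: union_nbhds_def Neighbours_def intro!: exI[of _ "{x}"])
  moreover have "y \<in> ?S" using assms in_arcsD2 by (auto simp: neighbours_def)
  ultimately have "{{}, ?S} \<subseteq> union_nbhds G A" "{} \<noteq> ?S"
    using empty_in_union_nbhds by auto
  then show ?thesis
    unfolding cut_card_def
    by (metis card_2_iff card_mono union_nbhds_finite assms(1))
qed

text \<open>An arc leaving the extended set would give it cut value 2. An arc inside it that starts
  at the new vertex ends in the old set, where its reversal contradicts the induction
  hypothesis.\<close>

lemma reach_1_no_arc:
  assumes "reach G 1 A" "x \<in> A"
  shows "(x, y) \<notin> parcs G"
proof -
  have "\<forall>x\<in>A. \<forall>y. (x, y) \<notin> parcs G" using assms(1)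
  proof induction
    case (insert A v)
    then have fin: "finite (insert v A)" using reach_finite by blast
    show ?case
    proof (intro ballI allI notI)
      fix x y assume x: "x \<in> insert v A" and e: "(x, y) \<in> parcs G"
      have "y \<in> insert v A"
        using cut_card_ge_2[OF fin x _ e] insert.hyps(4) by force
      moreover have "(y, x) \<in> parcs G" using e pair_sym_arcs by (auto simp: symmetric_def dest: symD)
      ultimately show False using insert.IH x e no_loops' by blast
    qed
  qed simp
  then show ?thesis using assms(2) by blast
qed

text \<open>The leaves of a decomposition tree never determine its width: a singleton has at most two
  unions of neighbourhoods, and any edge has to cross one of the cuts of the ordering.\<close>

lemma reach_singleton:
  assumes "reach G k (pverts G)" "v \<in> pverts G"
  shows "cut_card G {v} \<le> k"
proof (cases "k = 1")
  case True
  then have "neighbours G v = {}"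
    using reach_1_no_arc assms by (auto simp: neighbours_def)
  then have "union_nbhds G {v} \<subseteq> {{}}"
    by (auto simp: union_nbhds_def Neighbours_def)
  then have "cut_card G {v} \<le> card {{}::'a set}" unfolding cut_card_def by (intro card_mono) auto
  then show ?thesis using True by simp
next
  case False
  then have "2 \<le> k" using reach_pos[OF assms(1)] by simp
  then show ?thesis using cut_card_le_inside[of "{v}" G] by simp
qed

text \<open>The tree is a caterpillar in which the vertex added last hangs at the root. Singletons
  need a bound of their own because leaves are nodes and count in the width.\<close>

lemma reach_linear_tree:
  assumes "reach G k A" "A \<noteq> {}" "\<forall>v\<in>pverts G. cut_card G {v} \<le> k"
  shows "\<exists>T. distinct (leaves T) \<and> set (leaves T) = A \<and>
    (\<forall>l r. Node l r \<in> nodes T \<longrightarrow> (\<exists>v. l = Leaf v) \<or> (\<exists>v. r = Leaf v)) \<and>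
    (\<forall>w\<in>nodes T. cut_card G (set (leaves w)) \<le> k)"
  using assms
proof (induction)
  case empty
  then show ?case by simp
next
  case (insert A v)
  show ?case
  proof (cases "A = {}")
    case True
    then show ?thesis using insert by (intro exI[of _ "Leaf v"]) auto
  next
    case False
    then obtain T where "distinct (leaves T)" "set (leaves T) = A"
      "\<forall>l r. Node l r \<in> nodes T \<longrightarrow> (\<exists>v. l = Leaf v) \<or> (\<exists>v. r = Leaf v)"
      "\<forall>w\<in>nodes T. cut_card G (set (leaves w)) \<le> k"
      using insert by blast
    then show ?thesis using insert by (intro exI[of _ "Node (Leaf v) T"]) auto
  qed
qed

lemma boolean_width_le_iff:
  assumes "set (leaves T) \<subseteq> pverts G" "1 \<le> k"
  shows "boolean_width G T \<le> log 2 (real k) \<longleftrightarrow> (\<forall>w\<in>nodes T. cut_card G (set (leaves w)) \<le> k)"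
proof -
  have "booldim G (set (leaves w)) \<le> log 2 (real k) \<longleftrightarrow> cut_card G (set (leaves w)) \<le> k" for w
    using cut_card_pos[of "set (leaves w)" G] assms(2)
    by (simp add: booldim_def cut_card_def[symmetric])
  then show ?thesis
    unfolding boolean_width_def by (subst Max_le_iff) (auto simp: finite_nodes nodes_nonempty)
qed

text \<open>Both sides are compared through thresholds: an optimal chain yields a tree of no larger
  width, and the largest cut value in any linear tree is a threshold at which the whole vertex set
  is reached.\<close>

lemma lbw_eq_log_bottleneck:
  assumes "pverts G \<noteq> {}"
  shows "lbw G = log 2 (real (bottleneck G (pverts G)))"
  unfolding lbw_def
proof (rule antisym)
  note fin = pair_finite_verts
  let ?W = "{boolean_width G T | T. linear_decomposition G T}"
  let ?k = "bottleneck G (pverts G)"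
  have k: "1 \<le> ?k" "reach G ?k (pverts G)"
    using bottleneck_pos[OF fin] bottleneck_le_iff[OF fin] by auto
  obtain T where T: "distinct (leaves T)" "set (leaves T) = pverts G"
    "\<forall>l r. Node l r \<in> nodes T \<longrightarrow> (\<exists>v. l = Leaf v) \<or> (\<exists>v. r = Leaf v)"
    "\<forall>w\<in>nodes T. cut_card G (set (leaves w)) \<le> ?k"
    using reach_linear_tree[OF k(2) assms] reach_singleton[OF k(2)] by blast
  then have "boolean_width G T \<in> ?W"
    by (auto simp: linear_decomposition_def decomposition_tree_def)
  moreover have "boolean_width G T \<le> log 2 (real ?k)"
    using boolean_width_le_iff T k by simp
  ultimately show "Min ?W \<le> log 2 (real ?k)"
    using finite_linear_widths[OF fin] by (meson Min_le order_trans)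
  show "log 2 (real ?k) \<le> Min ?W"
  proof (rule Min.boundedI)
    show "finite ?W" by (rule finite_linear_widths[OF fin])
    show "?W \<noteq> {}" using linear_decomposition_exists[OF fin assms] by blast
    fix b assume "b \<in> ?W"
    then obtain T where T: "linear_decomposition G T" and b: "b = boolean_width G T" by blast
    then have leaves: "distinct (leaves T)" "set (leaves T) = pverts G"
      by (auto simp: linear_decomposition_def decomposition_tree_def)
    define k where "k = Max ((\<lambda>w. cut_card G (set (leaves w))) ` nodes T)"
    have le: "\<forall>w\<in>nodes T. cut_card G (set (leaves w)) \<le> k"
      unfolding k_def by (auto simp: finite_nodes)
    have "k \<in> (\<lambda>w. cut_card G (set (leaves w))) ` nodes T"
      unfolding k_def by (rule Max_in) (auto simp: finite_nodes nodes_nonempty)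
    then obtain w where w: "w \<in> nodes T" "k = cut_card G (set (leaves w))" by blast
    have "1 \<le> k" unfolding w(2) by (rule cut_card_pos) simp
    then have "reach G k (pverts G)"
      using linear_tree_reach[of T G k] leaves le T by (simp add: linear_decomposition_def)
    then have "log 2 (real ?k) \<le> log 2 (real k)"
      using bottleneck_le_iff[OF fin order_refl, of k] k(1) by simp
    also have "\<dots> = booldim G (set (leaves w))"
      by (simp add: w(2) booldim_def cut_card_def)
    also have "\<dots> \<le> b"
      unfolding b boolean_width_def using w(1) by (auto simp: finite_nodes)
    finally show "log 2 (real ?k) \<le> b" .
  qed
qed

end

text \<open>Subsets of \<open>insert v A\<close> are split by whether they contain \<open>v\<close>,
  and \<open>v\<close> itself leaves the complement. Each old union thus yields two candidates, so
  the work is proportional to the length of the old list.\<close>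

lemma union_nbhds_insert:
  assumes "v \<notin> A" "v \<in> pverts G" "neighbours G v \<subseteq> pverts G"
  shows "union_nbhds G (insert v A) =
    (\<lambda>S. S - {v}) ` union_nbhds G A \<union>
    (\<lambda>S. (S - {v}) \<union> (neighbours G v - insert v A)) ` union_nbhds G A"
proof -
  have 1: "Neighbours G X \<inter> (pverts G - insert v A) = Neighbours G X \<inter> (pverts G - A) - {v}" for X
    by auto
  have 2: "Neighbours G (insert v X) \<inter> (pverts G - insert v A) =
    (Neighbours G X \<inter> (pverts G - A) - {v}) \<union> (neighbours G v - insert v A)" for X
    using assms(3) by (auto simp: Neighbours_def)
  show ?thesis
    unfolding union_nbhds_image Pow_insert image_Un image_image 2 by (simp only: 1)
qed

section \<open>Weakest preconditions with elapsed time\<close>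

text \<open>Total correctness with a clock: \<open>t\<close> is the time spent so far, and the
  postcondition receives the absolute end time.\<close>

definition wp :: "machine \<Rightarrow> 'v com \<Rightarrow> 'v state \<Rightarrow> nat \<Rightarrow> (nat \<Rightarrow> 'v state \<Rightarrow> bool) \<Rightarrow> bool" where
  "wp M c s t Q \<longleftrightarrow> (\<exists>u s'. exec M c s u s' \<and> Q (t + u) s')"

inductive_cases exec_elims:
  "exec M Skip s t s'"
  "exec M (IAssign x a) s t s'"
  "exec M (SAssign x A) s t s'"
  "exec M (IStore a b) s t s'"
  "exec M (SStore a A) s t s'"
  "exec M (Seq c d) s t s'"
  "exec M (Cond b c d) s t s'"

text \<open>Determinism turns the existential into an equation, so that the rules for atomic
  commands are equivalences and serve as rewrite rules for symbolic execution.\<close>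

lemma wp_iff: "exec M c s u s' \<Longrightarrow> wp M c s t Q \<longleftrightarrow> Q (t + u) s'"
  unfolding wp_def using exec_deterministic by blast

lemma wp_Skip [simp]: "wp M Skip s t Q \<longleftrightarrow> Q (t + 1) s"
  by (rule wp_iff, rule exec.Skip)

lemma wp_IAssign [simp]:
  "wp M (IAssign x a) s t Q \<longleftrightarrow> ifits M s a \<and>
     Q (t + (icost (set_size M) a + 1)) (s\<lparr>ireg := (ireg s)(x := ival s a)\<rparr>)"
  using wp_iff[OF exec.IAssign, of M s a x t Q] by (auto simp: wp_def elim: exec_elims)

lemma wp_SAssign [simp]:
  "wp M (SAssign x A) s t Q \<longleftrightarrow> sfits M s A \<and>
     Q (t + (scost (set_size M) A + set_size M)) (s\<lparr>sreg := (sreg s)(x := sval s A)\<rparr>)"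
  using wp_iff[OF exec.SAssign, of M s A x t Q] by (auto simp: wp_def elim: exec_elims)

lemma wp_IStore [simp]:
  "wp M (IStore a b) s t Q \<longleftrightarrow> ifits M s a \<and> ival s a < icells M \<and> ifits M s b \<and>
     Q (t + (icost (set_size M) a + icost (set_size M) b + 1))
       (s\<lparr>imem := (imem s)(ival s a := ival s b)\<rparr>)"
  using wp_iff[OF exec.IStore, of M s a b t Q] by (auto simp: wp_def elim: exec_elims)

lemma wp_SStore [simp]:
  "wp M (SStore a A) s t Q \<longleftrightarrow> ifits M s a \<and> ival s a < scells M \<and> sfits M s A \<and>
     Q (t + (icost (set_size M) a + scost (set_size M) A + set_size M))
       (s\<lparr>smem := (smem s)(ival s a := sval s A)\<rparr>)"
  using wp_iff[OF exec.SStore, of M s a A t Q] by (auto simp: wp_def elim: exec_elims)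

lemma wp_Seq [simp]: "wp M (Seq c d) s t Q \<longleftrightarrow> wp M c s t (\<lambda>t' s'. wp M d s' t' Q)"
  unfolding wp_def by (fastforce elim!: exec_elims intro: exec.intros simp: add.assoc)

lemma wp_Cond [simp]:
  "wp M (Cond b c d) s t Q \<longleftrightarrow> bfits M s b \<and>
     (if bval s b then wp M c s (t + (bcost (set_size M) b + 1)) Q
      else wp M d s (t + (bcost (set_size M) b + 1)) Q)" (is "?L = ?R")
proof
  assume ?L
  then obtain u s' where "exec M (Cond b c d) s u s'" "Q (t + u) s'"
    unfolding wp_def by blast
  then show ?R
    by (elim exec_elims) (auto simp: wp_def add_ac)
next
  assume R: ?R
  show ?L
  proof (cases "bval s b")
    case True
    with R obtain u s' where "exec M c s u s'" "Q (t + (bcost (set_size M) b + 1) + u) s'"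
      unfolding wp_def by auto
    with R True exec.CondTrue[of M s b c u s' d] show ?thesis
      unfolding wp_def by (auto intro!: exI simp: add_ac)
  next
    case False
    with R obtain u s' where "exec M d s u s'" "Q (t + (bcost (set_size M) b + 1) + u) s'"
      unfolding wp_def by auto
    with R False exec.CondFalse[of M s b d u s' c] show ?thesis
      unfolding wp_def by (auto intro!: exI simp: add_ac)
  qed
qed

text \<open>Exchanges the state term produced by symbolic execution for an equal one of a chosen
  form.\<close>

lemma wp_state_eq: "s = s' \<Longrightarrow> wp M c s' t Q \<Longrightarrow> wp M c s t Q"
  by simp

lemma wp_mono:
  assumes "wp M c s t P" "\<And>t s. P t s \<Longrightarrow> Q t s"
  shows "wp M c s t Q"
  using assms unfolding wp_def by blast

text \<open>Makes the simplifier execute a program forwards, instead of first descending into the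
  postcondition.\<close>

lemma wp_cong [cong]: "s = s' \<Longrightarrow> t = t' \<Longrightarrow> wp M c s t Q \<longleftrightarrow> wp M c s' t' Q"
  by simp

text \<open>The bound on the elapsed time doubles as the termination argument.\<close>

lemma wp_While:
  assumes "I t s"
    and fits: "\<And>t s. I t s \<Longrightarrow> bfits M s b"
    and bound: "\<And>t s. I t s \<Longrightarrow> t \<le> B"
    and step: "\<And>t s. I t s \<Longrightarrow> bval s b \<Longrightarrow> wp M c s (t + (bcost (set_size M) b + 1)) I"
    and exit: "\<And>t s. I t s \<Longrightarrow> \<not> bval s b \<Longrightarrow> Q (t + (bcost (set_size M) b + 1)) s"
  shows "wp M (While b c) s t Q"
  using assms(1)
proof (induction "B - t" arbitrary: t s rule: less_induct)
  case less
  show ?case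
  proof (cases "bval s b")
    case True
    from step[OF less.prems True] obtain u s'
      where u: "exec M c s u s'" "I (t + (bcost (set_size M) b + 1) + u) s'"
      unfolding wp_def by blast
    have "B - (t + (bcost (set_size M) b + 1) + u) < B - t"
      using bound[OF u(2)] by linarith
    from less.hyps[OF this u(2)] obtain w s2
      where w: "exec M (While b c) s' w s2" "Q (t + (bcost (set_size M) b + 1) + u + w) s2"
      unfolding wp_def by blast
    from exec.WhileTrue[OF fits[OF less.prems] True u(1) w(1)] w(2) show ?thesis
      unfolding wp_def by (auto intro!: exI simp: add_ac)
  next
    case False
    from exec.WhileFalse[OF fits[OF less.prems] False, of c] exit[OF less.prems False]
    show ?thesis unfolding wp_def by (auto intro!: exI)
  qed
qed

section \<open>The program\<close>

abbreviation Seq_infix :: "'v com \<Rightarrow> 'v com \<Rightarrow> 'v com" (infixr ";;" 60) where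
  "c ;; d \<equiv> Seq c d"

text \<open>
  With \<open>m = 2 ^ n\<close>, the word memory consists of five blocks of \<open>m\<close> cells, starting at \<open>0\<close> and at
  the contents of the registers \<open>''m''\<close>, \<open>''2''\<close>, \<open>''3''\<close>, \<open>''4''\<close>: the powers of two; the
  characteristic function of the current set; the search stack, listing the elements of the current
  set in the order of their insertion; a table indexed by vertex sets; and, indexed by vertex sets
  as well, the index of the last set whose list of unions of neighbourhoods received this element.
  The list for the set on level \<open>i\<close> of the stack starts at the bitset cell \<open>n + 2 ^ (n - i)\<close>.  The
  table entry \<open>2 * m\<close> means infinity.
\<close>

definition init_com :: "string com" where
  "init_com =
    IAssign ''j'' (Const 0) ;; IAssign ''m'' (Const 1) ;;
    While (Less (IReg ''j'') (IReg ''n''))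
      (IStore (IReg ''j'') (IReg ''m'') ;; IAssign ''m'' (Plus (IReg ''m'') (IReg ''m'')) ;;
       IAssign ''j'' (Plus (IReg ''j'') (Const 1))) ;;
    IStore (IReg ''n'') (IReg ''m'') ;;
    IAssign ''2'' (Plus (IReg ''m'') (IReg ''m'')) ;;
    IAssign ''3'' (Plus (IReg ''2'') (IReg ''m'')) ;;
    IAssign ''4'' (Plus (IReg ''3'') (IReg ''m''))"

text \<open>The block of the characteristic function is not reset, because a search ends with an
  empty stack and leaves it zero. The empty set enters the table with value 1, and its one-element
  list goes to the slot of level 0, at cell \<open>n + m\<close>.\<close>

definition clear_com :: "string com" where
  "clear_com =
    IAssign ''j'' (Const 0) ;;
    While (Less (IReg ''j'') (IReg ''m''))
      (IStore (Plus (IReg ''3'') (IReg ''j'')) (IReg ''2'') ;;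
       IStore (Plus (IReg ''4'') (IReg ''j'')) (Const 0) ;;
       IAssign ''j'' (Plus (IReg ''j'') (Const 1))) ;;
    IAssign ''a'' (Const 0) ;; IAssign ''i'' (Const 0) ;; IAssign ''v'' (Const 0) ;;
    SAssign ''A'' SEmpty ;;
    IStore (IReg ''3'') (Const 1) ;;
    SStore (Plus (IReg ''n'') (IReg ''m'')) SEmpty"

text \<open>Duplicates are recognised by a mark at the index of the candidate. Using the index
  \<open>x\<close> of the set under construction as the mark, instead of a flag, lets old marks
  expire by themselves; clearing them for every list would cost too much.\<close>

definition add_com :: "string com" where
  "add_com =
    IAssign ''y'' (Plus (IReg ''4'') (Index (SReg ''S''))) ;;
    Cond (IEq (ILoad (IReg ''y'')) (IReg ''x'')) Skip
      (IStore (IReg ''y'') (IReg ''x'') ;;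
       SStore (Plus (IReg ''q'') (IReg ''c'')) (SReg ''S'') ;;
       IAssign ''c'' (Plus (IReg ''c'') (Const 1)))"

definition list_com :: "string com" where
  "list_com =
    IAssign ''x'' (Plus (IReg ''a'') (ILoad (IReg ''v''))) ;;
    SAssign ''W'' (SUnion (SReg ''A'') (SSingleton (IReg ''v''))) ;;
    SAssign ''N'' (SDiff (SLoad (IReg ''v'')) (SReg ''W'')) ;;
    IAssign ''l'' (ILoad (Plus (IReg ''3'') (IReg ''a''))) ;;
    IAssign ''p'' (Plus (IReg ''n'') (ILoad (Minus (IReg ''n'') (IReg ''i'')))) ;;
    IAssign ''q'' (Plus (IReg ''n'') (ILoad (Minus (Minus (IReg ''n'') (IReg ''i'')) (Const 1)))) ;;
    IAssign ''c'' (Const 0) ;; IAssign ''j'' (Const 0) ;;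
    While (Less (IReg ''j'') (IReg ''l''))
      (SAssign ''S'' (SDiff (SLoad (Plus (IReg ''p'') (IReg ''j''))) (SSingleton (IReg ''v''))) ;;
       add_com ;;
       SAssign ''S'' (SUnion (SReg ''S'') (SReg ''N'')) ;;
       add_com ;;
       IAssign ''j'' (Plus (IReg ''j'') (Const 1)))"

definition next_com :: "string com" where
  "next_com = IAssign ''v'' (Plus (IReg ''v'') (Const 1))"

definition push_com :: "string com" where
  "push_com =
    IStore (Plus (IReg ''2'') (IReg ''i'')) (IReg ''v'') ;;
    IStore (Plus (IReg ''m'') (IReg ''v'')) (Const 1) ;;
    SAssign ''A'' (SReg ''W'') ;;
    IAssign ''a'' (IReg ''x'') ;;
    IAssign ''i'' (Plus (IReg ''i'') (Const 1)) ;;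
    IAssign ''v'' (Const 0)"

definition pop_com :: "string com" where
  "pop_com =
    IAssign ''i'' (Minus (IReg ''i'') (Const 1)) ;;
    IAssign ''v'' (ILoad (Plus (IReg ''2'') (IReg ''i''))) ;;
    IAssign ''a'' (Minus (IReg ''a'') (ILoad (IReg ''v''))) ;;
    SAssign ''A'' (SDiff (SReg ''A'') (SSingleton (IReg ''v''))) ;;
    IStore (Plus (IReg ''m'') (IReg ''v'')) (Const 0) ;;
    next_com"

text \<open>A set beyond the threshold is recorded in the table although it is not pushed, so that
  its list is computed only once per round.\<close>

definition step_com :: "string com" where
  "step_com =
    Cond (IEq (IReg ''v'') (IReg ''n'')) pop_com
      (Cond (BAnd (IEq (ILoad (Plus (IReg ''m'') (IReg ''v''))) (Const 0))
          (IEq (ILoad (Plus (IReg ''3'') (Plus (IReg ''a'') (ILoad (IReg ''v''))))) (IReg ''2'')))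
        (list_com ;;
         IStore (Plus (IReg ''3'') (IReg ''x'')) (IReg ''c'') ;;
         Cond (Less (IReg ''T'') (IReg ''c'')) next_com push_com)
        next_com)"

definition search_com :: "string com" where
  "search_com =
    While (BNot (BAnd (IEq (IReg ''i'') (Const 0)) (IEq (IReg ''v'') (IReg ''n'')))) step_com"

text \<open>Reads off the binary digits of \<open>a\<close> from the top without division:
  \<open>r\<close> is the part of the index below the current position, and \<open>v\<close> is an
  element exactly if \<open>2 ^ v \<le> r\<close>.\<close>

definition min_com :: "string com" where
  "min_com =
    IAssign ''d'' (IReg ''2'') ;; IAssign ''r'' (IReg ''a'') ;; IAssign ''v'' (IReg ''n'') ;;
    While (Less (Const 0) (IReg ''v''))
      (IAssign ''v'' (Minus (IReg ''v'') (Const 1)) ;;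
       Cond (Less (IReg ''r'') (ILoad (IReg ''v''))) Skip
         (IAssign ''r'' (Minus (IReg ''r'') (ILoad (IReg ''v''))) ;;
          IAssign ''y''
            (ILoad (Plus (IReg ''3'') (Minus (IReg ''a'') (ILoad (IReg ''v''))))) ;;
          Cond (Less (IReg ''y'') (IReg ''d'')) (IAssign ''d'' (IReg ''y'')) Skip))"

text \<open>Removing an element lowers the index, so increasing index is a valid order of evaluation
  and the table can be overwritten in place.\<close>

definition dp_com :: "string com" where
  "dp_com =
    IAssign ''a'' (Const 1) ;;
    While (Less (IReg ''a'') (IReg ''m''))
      (min_com ;;
       Cond (Less (ILoad (Plus (IReg ''3'') (IReg ''a''))) (IReg ''d''))
         (IStore (Plus (IReg ''3'') (IReg ''a'')) (IReg ''d'')) Skip ;;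
       IAssign ''a'' (Plus (IReg ''a'') (Const 1)))"

definition read_com :: "string com" where
  "read_com = IAssign ''out'' (ILoad (Plus (IReg ''3'') (Minus (IReg ''m'') (Const 1))))"

text \<open>The initial values 1 of \<open>out\<close> and 0 of \<open>T\<close> force a first
  round, which has threshold 1. After a round, \<open>out\<close> not exceeding \<open>T\<close>
  means that the full vertex set was reached.\<close>

definition lbw_com :: "string com" where
  "lbw_com =
    init_com ;;
    IAssign ''out'' (Const 1) ;; IAssign ''T'' (Const 0) ;;
    While (Less (IReg ''T'') (IReg ''out''))
      (IAssign ''T'' (Plus (Plus (IReg ''T'') (IReg ''T'')) (Const 1)) ;;
       clear_com ;; search_com ;; read_com) ;;
    dp_com ;; read_com"

section \<open>Correctness and running time\<close>

text \<open>The word bound leaves slack: the numbers computed, addresses included, stay below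
  \<open>5 * m\<close>.\<close>

locale lbw_run = pair_graph G for G :: "nat pair_pre_digraph" +
  fixes n m :: nat and M :: machine
  assumes vertices: "pverts G = {..<n}" and n_pos: "0 < n" and m_eq: "m = 2 ^ n"
    and size: "set_size M = n" and words: "8 * m < 2 ^ word_size M"
    and icells: "5 * m \<le> icells M" and scells: "n + 2 * m \<le> scells M"
begin

declare power_strict_increasing_iff [simp del] power_increasing_iff [simp del]

text \<open>Ensures that the \<open>n + 1\<close> powers of two fit in the first block.\<close>

lemma n_less: "n < m"
  by (simp add: m_eq)

lemmas resources = n_pos n_less words icells scells

lemma pow_le: "j \<le> n \<Longrightarrow> 2 ^ j \<le> m"
  by (simp add: m_eq power_increasing)

lemma pow_le2: "j \<le> n \<Longrightarrow> 2 ^ j \<le> 2 * m"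
  using pow_le[of j] by simp

text \<open>The global bounds on words and bitsets are what discharges the overflow conditions of
  all loads.\<close>

definition ready :: "string state \<Rightarrow> bool" where
  "ready s \<longleftrightarrow> ireg s ''n'' = n \<and> ireg s ''m'' = m \<and> ireg s ''2'' = 2 * m \<and>
     ireg s ''3'' = 3 * m \<and> ireg s ''4'' = 4 * m \<and>
     (\<forall>v\<le>n. imem s v = 2 ^ v) \<and> (\<forall>k. imem s k \<le> 2 * m) \<and>
     (\<forall>v<n. smem s v = neighbours G v) \<and> (\<forall>k. smem s k \<subseteq> {..<n})"

lemma neighbours_subset: "neighbours G v \<subseteq> {..<n}"
  using in_arcsD2 vertices by (auto simp: neighbours_def)

lemma init_correct:
  "wp M init_com (input G n) t (\<lambda>t' s. t' \<le> t + 100 * n \<and> ready s \<and>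
     (\<forall>v<n. imem s (m + v) = 0))"
proof -
  let ?I = "\<lambda>t' s. ireg s ''j'' \<le> n \<and>
       t' + 20 * (n - ireg s ''j'') \<le> t + 4 + 20 * n \<and>
       ireg s ''n'' = n \<and> ireg s ''m'' = 2 ^ ireg s ''j'' \<and>
       imem s = (\<lambda>v. if v < ireg s ''j'' then 2 ^ v else 0) \<and>
       smem s = (\<lambda>v. if v < n then neighbours G v else {})"
  show ?thesis
    unfolding init_com_def wp_Seq
    apply (simp only: wp_IAssign wp_Seq)
    apply (intro conjI)
      defer defer
    apply (rule wp_While[where B = "t + 4 + 20 * n" and I = ?I])
    subgoal by (simp add: input_def)
    subgoal for t' s' using resources by simp
    subgoal by simp
    subgoal for t' s' using pow_le[of "ireg s' ''j''"] pow_le[of "Suc (ireg s' ''j'')"] resources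
      by (auto simp add: fun_eq_iff size)
    subgoal for t' s'  using resources neighbours_subset
      apply (auto simp add: size ready_def pow_le2 m_eq[symmetric]) done
    subgoal using resources by simp
    subgoal using resources by simp
    done
qed

section \<open>Computing the duplicate-free list of a new set\<close>

definition collected :: "nat \<Rightarrow> nat \<Rightarrow> nat set set \<Rightarrow> string state \<Rightarrow> bool" where
  "collected x q D s \<longleftrightarrow> bij_betw (\<lambda>k. smem s (q + k)) {..<ireg s ''c''} D \<and>
     (\<forall>y<m. imem s (4 * m + y) = x \<longleftrightarrow> y \<in> set_encode ` D)"

text \<open>Here \<open>x\<close> is the index of the set whose list is being built, and
  \<open>lo\<close> and \<open>hi\<close> delimit its slot. For the marks it suffices that a changed
  cell now holds \<open>x\<close>: this is all that the freshness of later indices depends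
  on.\<close>

definition frame :: "nat \<Rightarrow> nat \<Rightarrow> nat \<Rightarrow> string state \<Rightarrow> string state \<Rightarrow> bool" where
  "frame x lo hi s s' \<longleftrightarrow>
     (\<forall>r. r \<notin> {''y'', ''c'', ''j''} \<longrightarrow> ireg s' r = ireg s r) \<and>
     (\<forall>r. r \<noteq> ''S'' \<longrightarrow> sreg s' r = sreg s r) \<and>
     (\<forall>k<4 * m. imem s' k = imem s k) \<and>
     (\<forall>k. imem s' k = imem s k \<or> imem s' k = x) \<and>
     (\<forall>k. k < lo \<or> hi \<le> k \<longrightarrow> smem s' k = smem s k)"

lemma frame_trans: "frame x lo hi s s' \<Longrightarrow> frame x lo hi s' s'' \<Longrightarrow> frame x lo hi s s''"
  unfolding frame_def by (elim conjE, intro conjI) (simp, simp, simp, metis, simp)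

lemma frame_ready:
  assumes "ready s" "frame x lo hi s s'" "n \<le> lo" "x \<le> 2 * m" "\<forall>k. smem s' k \<subseteq> {..<n}"
  shows "ready s'"
proof -
  have "imem s' k = imem s k \<or> imem s' k = x" for k
    using assms(2) by (simp add: frame_def)
  then have "imem s' k \<le> 2 * m" for k
    using assms(1,4) unfolding ready_def by metis
  moreover have "imem s' v = 2 ^ v" if "v \<le> n" for v
  proof -
    have "v < 4 * m" using that n_less by simp
    then show ?thesis using assms(1,2) that by (simp add: ready_def frame_def)
  qed
  ultimately show ?thesis
    using assms by (simp add: ready_def frame_def)
qed

lemma set_encode_less: "A \<subseteq> {..<n} \<Longrightarrow> set_encode A < m"
proof -
  assume A: "A \<subseteq> {..<n}"
  then have "set_encode A \<le> set_encode {..<n}"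
    by (simp add: set_encode_def sum_mono2)
  also have "\<dots> < m"
    using n_pos by (simp add: set_encode_def m_eq mask_eq_sum_exp_nat[symmetric] lessThan_def)
  finally show ?thesis .
qed

lemma set_encode_eq_iff:
  "A \<subseteq> {..<n} \<Longrightarrow> B \<subseteq> {..<n} \<Longrightarrow> set_encode A = set_encode B \<longleftrightarrow> A = B"
  by (meson finite_lessThan finite_subset set_encode_eq)

lemma inj_on_set_encode_Pow: "inj_on set_encode (Pow {..<n})"
  using set_encode_eq_iff by (simp add: inj_on_def)

text \<open>\<open>U\<close> is the final collection. As long as the candidate is missing from
  \<open>D\<close>, the duplicate-free list is shorter than \<open>U\<close>, so the slot with
  capacity \<open>2 ^ e\<close> cannot overflow.\<close>

lemma add_correct:
  assumes ready: "ready s" and x: "ireg s ''x'' < m" and q: "ireg s ''q'' = n + 2 ^ e" "e < n"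
    and D: "collected (ireg s ''x'') (n + 2 ^ e) D s"
    and U: "insert (sreg s ''S'') D \<subseteq> U" "finite U" "card U \<le> 2 ^ e" "U \<subseteq> Pow {..<n}"
  shows "wp M add_com s t (\<lambda>t' s'. t' \<le> t + 40 * n \<and> ready s' \<and>
     collected (ireg s ''x'') (n + 2 ^ e) (insert (sreg s ''S'') D) s' \<and>
     frame (ireg s ''x'') (n + 2 ^ e) (n + 2 ^ (e + 1)) s s' \<and>
     ireg s' ''j'' = ireg s ''j'' \<and> sreg s' = sreg s)"
proof -
  let ?S = "sreg s ''S''" and ?x = "ireg s ''x''" and ?c = "ireg s ''c''"
  have e: "(2::nat) ^ e + 2 ^ e \<le> m"
    using pow_le[of "Suc e"] q by simp
  have S: "?S \<subseteq> {..<n}" "set_encode ?S < m" using U set_encode_less by auto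
  have bij: "bij_betw (\<lambda>k. smem s (n + 2 ^ e + k)) {..<?c} D"
    and mark: "\<And>y. y < m \<Longrightarrow> imem s (4 * m + y) = ?x \<longleftrightarrow> y \<in> set_encode ` D"
    using D by (auto simp: collected_def)
  have c: "?c = card D" using bij_betw_same_card[OF bij] by simp
  have mem: "imem s (4 * m + set_encode ?S) = ?x \<longleftrightarrow> ?S \<in> D"
  proof -
    have "set_encode ?S \<in> set_encode ` D \<longleftrightarrow> ?S \<in> D"
      by (rule inj_on_image_mem_iff[OF inj_on_set_encode_Pow]) (use U in auto)
    then show ?thesis using mark S by simp
  qed
  have rd: "ireg s ''4'' = 4 * m" "\<And>k. imem s k \<le> 2 * m"
    using ready by (auto simp: ready_def)
  have fits: "imem s k < 2 ^ word_size M" for k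
    using rd(2)[of k] resources by linarith
  show ?thesis
  proof (cases "?S \<in> D")
    case True
    then have D': "insert ?S D = D" by blast
    show ?thesis
      unfolding add_com_def using rd fits S x resources mem True ready D
      by (simp add: size D' frame_def ready_def collected_def)
  next
    case False
    have "card (insert ?S D) \<le> card U" using U by (intro card_mono) auto
    then have c_less: "?c < 2 ^ e"
      using False U c finite_subset[of D U] by simp
    let ?s = "s\<lparr>imem := (imem s)(4 * m + set_encode ?S := ?x),
      smem := (smem s)(n + 2 ^ e + ?c := ?S),
      ireg := (ireg s)(''y'' := 4 * m + set_encode ?S, ''c'' := Suc ?c)\<rparr>"
    have frame: "frame ?x (n + 2 ^ e) (n + 2 ^ (e + 1)) s ?s"
      using c_less by (simp add: frame_def)
    have "\<forall>k. smem ?s k \<subseteq> {..<n}" using S ready by (simp add: ready_def)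
    then have ready': "ready ?s" using frame_ready[OF ready frame] x by simp
    have "bij_betw (\<lambda>k. smem ?s (n + 2 ^ e + k)) {..<Suc ?c} (insert ?S D)"
    proof -
      have "bij_betw (\<lambda>k. smem ?s (n + 2 ^ e + k)) {..<?c} D"
        using bij by (rule bij_betw_cong[THEN iffD1, rotated]) simp
      then have "bij_betw (\<lambda>k. smem ?s (n + 2 ^ e + k)) ({..<?c} \<union> {?c}) (D \<union> {?S})"
        using notIn_Un_bij_betw[of ?c "{..<?c}" "\<lambda>k. smem ?s (n + 2 ^ e + k)" D] False by simp
      then show ?thesis by (simp add: lessThan_Suc)
    qed
    then have coll: "collected ?x (n + 2 ^ e) (insert ?S D) ?s"
      using mark by (auto simp: collected_def)
    show ?thesis
      unfolding add_com_def using rd fits S x resources mem False q e c_less ready' coll frame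
      by (simp add: size)
  qed
qed

text \<open>The slot of the new set ends where that of its parent begins, so the parent's list stays
  intact while it is read. The assumption \<open>fresh\<close> holds because a set is generated at
  most once per round.\<close>

lemma list_correct:
  assumes ready: "ready s" and A: "sreg s ''A'' = A" "A \<subseteq> {..<n}" "ireg s ''a'' = set_encode A"
      "ireg s ''i'' = card A"
    and v: "ireg s ''v'' = v" "v < n" "v \<notin> A"
    and tab: "imem s (3 * m + set_encode A) = cut_card G A"
    and list: "bij_betw (\<lambda>k. smem s (n + 2 ^ (n - card A) + k)) {..<cut_card G A} (union_nbhds G A)"
    and fresh: "\<forall>y<m. imem s (4 * m + y) \<noteq> set_encode (insert v A)"
  shows "wp M list_com s t (\<lambda>t' s'. t' \<le> t + 200 * (n * (cut_card G A + 1)) \<and> ready s' \<and>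
     (\<forall>r. r \<notin> {''x'', ''l'', ''p'', ''q'', ''c'', ''j'', ''y''} \<longrightarrow> ireg s' r = ireg s r) \<and>
     ireg s' ''x'' = set_encode (insert v A) \<and> ireg s' ''c'' = cut_card G (insert v A) \<and>
     sreg s' ''A'' = A \<and> sreg s' ''W'' = insert v A \<and>
     bij_betw (\<lambda>k. smem s' (n + 2 ^ (n - card (insert v A)) + k))
       {..<cut_card G (insert v A)} (union_nbhds G (insert v A)) \<and>
     (\<forall>k<4 * m. imem s' k = imem s k) \<and>
     (\<forall>k. imem s' k = imem s k \<or> imem s' k = set_encode (insert v A)) \<and>
     (\<forall>k. n + 2 ^ (n - card A) \<le> k \<longrightarrow> smem s' k = smem s k))"
proof -
  let ?U = "union_nbhds G (insert v A)" and ?x = "set_encode (insert v A)"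
  have fin: "finite A" using A finite_subset by blast
  have A': "insert v A \<subseteq> {..<n}" using A v by auto
  have x: "?x = set_encode A + 2 ^ v" "?x < m"
    using fin v set_encode_less[OF A'] by (simp_all add: set_encode_insert)
  \<comment> \<open>The new slot occupies the cells from \<open>n + 2 ^ e\<close> up to
    \<open>n + 2 ^ (e + 1)\<close>, the start of the parent's list.\<close>
  define e where "e = n - card (insert v A)"
  have "card (insert v A) \<le> n" using A' card_mono[of "{..<n}" "insert v A"] by simp
  then have e: "n - card A = e + 1" "e < n" "n - card A - 1 = e" "card A \<le> n"
    using fin v n_pos by (simp_all add: e_def)
  have e': "n - Suc (card A) = e" using e by simp
  define N where "N = neighbours G v - insert v A"
  define S where "S j = smem s (n + 2 ^ (e + 1) + j)" for j
  \<comment> \<open>The collection after \<open>j\<close> entries of the parent's list have been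
    processed.\<close>
  define D where "D j = (\<lambda>k. S k - {v}) ` {..<j} \<union> (\<lambda>k. (S k - {v}) \<union> N) ` {..<j}" for j
  have im: "S ` {..<cut_card G A} = union_nbhds G A"
    using list unfolding S_def e(1) bij_betw_def by simp
  have D_all: "D (cut_card G A) = ?U"
  proof -
    have "?U = (\<lambda>X. X - {v}) ` (S ` {..<cut_card G A}) \<union>
        (\<lambda>X. (X - {v}) \<union> N) ` (S ` {..<cut_card G A})"
      unfolding im N_def using v neighbours_subset vertices by (intro union_nbhds_insert) auto
    then show ?thesis by (simp add: D_def image_image)
  qed
  have D_mono: "D j \<subseteq> ?U" if "j \<le> cut_card G A" for j
    unfolding D_all[symmetric] using that unfolding D_def by fastforce
  have D_Suc: "D (Suc j) = insert ((S j - {v}) \<union> N) (insert (S j - {v}) (D j))" for j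
    by (auto simp: D_def lessThan_Suc)
  have U: "finite ?U" "card ?U \<le> 2 ^ e" "?U \<subseteq> Pow {..<n}"
    using union_nbhds_finite[of "insert v A" G] fin cut_card_le_outside[of G "insert v A"] A' vertices
    by (auto simp: cut_card_def e_def union_nbhds_def)
  have cut: "cut_card G A \<le> m"
    using cut_card_le_outside[of G A] A(2) vertices pow_le[of "n - card A"] by simp
  \<comment> \<open>The state at loop entry in closed form; the frame condition of the loop refers
    to it.\<close>
  define s0 where "s0 = s\<lparr>ireg := (ireg s)(''x'' := ?x, ''l'' := cut_card G A,
      ''p'' := n + 2 ^ (e + 1), ''q'' := n + 2 ^ e, ''c'' := 0, ''j'' := 0),
      sreg := (sreg s)(''W'' := insert v A, ''N'' := N)\<rparr>"
  let ?I = "\<lambda>t' s'. ireg s' ''j'' \<le> cut_card G A \<and>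
    t' + 120 * (n * (cut_card G A - ireg s' ''j'')) \<le> t + 40 * n + 120 * (n * cut_card G A) \<and>
    ready s' \<and> frame ?x (n + 2 ^ e) (n + 2 ^ (e + 1)) s0 s' \<and>
    collected ?x (n + 2 ^ e) (D (ireg s' ''j'')) s'"
  have fr: "ireg s' ''x'' = ?x" "ireg s' ''l'' = cut_card G A" "ireg s' ''p'' = n + 2 ^ (e + 1)"
      "ireg s' ''q'' = n + 2 ^ e" "sreg s' ''W'' = insert v A" "sreg s' ''N'' = N"
      "ireg s' ''v'' = v" "n + 2 ^ (e + 1) \<le> k \<Longrightarrow> smem s' k = smem s k"
    if "frame ?x (n + 2 ^ e) (n + 2 ^ (e + 1)) s0 s'" for s' k
    using that v by (simp_all add: frame_def s0_def)
  have step: "wp M add_com (s'\<lparr>sreg := (sreg s')(''S'' := X)\<rparr>) t1 (\<lambda>t2 s2. t2 \<le> t1 + 40 * n \<and>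
      ready s2 \<and> frame ?x (n + 2 ^ e) (n + 2 ^ (e + 1)) s0 s2 \<and>
      collected ?x (n + 2 ^ e) (insert X E) s2 \<and> ireg s2 ''j'' = ireg s' ''j'' \<and>
      sreg s2 ''S'' = X)"
    if "ready s'" and f: "frame ?x (n + 2 ^ e) (n + 2 ^ (e + 1)) s0 s'"
      and "collected ?x (n + 2 ^ e) E s'" and "insert X E \<subseteq> ?U" for s' t1 X E
  proof -
    let ?s = "s'\<lparr>sreg := (sreg s')(''S'' := X)\<rparr>"
    have f': "frame ?x (n + 2 ^ e) (n + 2 ^ (e + 1)) s0 ?s" using f by (simp add: frame_def)
    have "wp M add_com ?s t1 (\<lambda>t2 s2. t2 \<le> t1 + 40 * n \<and> ready s2 \<and>
        collected (ireg ?s ''x'') (n + 2 ^ e) (insert (sreg ?s ''S'') E) s2 \<and>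
        frame (ireg ?s ''x'') (n + 2 ^ e) (n + 2 ^ (e + 1)) ?s s2 \<and>
        ireg s2 ''j'' = ireg ?s ''j'' \<and> sreg s2 = sreg ?s)"
      using that U e x fr[OF f]
      by (intro add_correct[where U = ?U]) (simp_all add: ready_def collected_def)
    then show ?thesis
      by (rule wp_mono) (use fr[OF f] frame_trans[OF f'] in auto)
  qed
  have loop: "wp M (While (Less (IReg ''j'') (IReg ''l''))
      (SAssign ''S'' (SDiff (SLoad (Plus (IReg ''p'') (IReg ''j''))) (SSingleton (IReg ''v''))) ;;
       add_com ;;
       SAssign ''S'' (SUnion (SReg ''S'') (SReg ''N'')) ;;
       add_com ;;
       IAssign ''j'' (Plus (IReg ''j'') (Const 1)))) s0 t0
     (\<lambda>t' s'. t' \<le> t + 200 * (n * (cut_card G A + 1)) \<and> ready s' \<and>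
       frame ?x (n + 2 ^ e) (n + 2 ^ (e + 1)) s0 s' \<and> collected ?x (n + 2 ^ e) ?U s')"
    if "t0 \<le> t + 40 * n" for t0
  proof (rule wp_While[where I = ?I and B = "t + 40 * n + 120 * (n * cut_card G A)"])
    \<comment> \<open>By \<open>fresh\<close> no mark equals the new index yet, which matches the
      empty collection \<open>D 0\<close>.\<close>
    show "?I t0 s0"
      using that ready fresh by (simp add: s0_def ready_def frame_def collected_def D_def bij_betw_def)
    show "bfits M s' (Less (IReg ''j'') (IReg ''l''))" if "?I t' s'" for t' s'
      using that fr[of s'] cut resources by simp
    show "t' \<le> t + 40 * n + 120 * (n * cut_card G A)" if "?I t' s'" for t' s'
      using that by simp
    show "t' + (bcost (set_size M) (Less (IReg ''j'') (IReg ''l'')) + 1) \<le> t + 200 * (n * (cut_card G A + 1)) \<and>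
       ready s' \<and> frame ?x (n + 2 ^ e) (n + 2 ^ (e + 1)) s0 s' \<and> collected ?x (n + 2 ^ e) ?U s'"
      if "?I t' s'" "\<not> bval s' (Less (IReg ''j'') (IReg ''l''))" for t' s'
      using that fr[of s'] n_pos by (auto simp: size algebra_simps D_all)
    fix t' s'
    assume I: "?I t' s'" and b: "bval s' (Less (IReg ''j'') (IReg ''l''))"
    then have f: "frame ?x (n + 2 ^ e) (n + 2 ^ (e + 1)) s0 s'" by simp
    define j where "j = ireg s' ''j''"
    have j: "j < cut_card G A" using b fr[OF f] by (simp add: j_def)
    show "wp M (SAssign ''S'' (SDiff (SLoad (Plus (IReg ''p'') (IReg ''j''))) (SSingleton (IReg ''v''))) ;;
       add_com ;;
       SAssign ''S'' (SUnion (SReg ''S'') (SReg ''N'')) ;;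
       add_com ;;
       IAssign ''j'' (Plus (IReg ''j'') (Const 1))) s' (t' + (bcost (set_size M) (Less (IReg ''j'') (IReg ''l'')) + 1)) ?I"
      (is "wp M ?body s' _ _")
    proof -
      have sub: "insert ((S j - {v}) \<union> N) (insert (S j - {v}) (D j)) \<subseteq> ?U"
        using D_mono[of "Suc j"] j D_Suc by simp
      have space: "(2::nat) ^ (e + 1) \<le> m" "cut_card G A \<le> m"
        using pow_le[of "e + 1"] e cut by simp_all
      have Sj: "smem s' (ireg s' ''p'' + ireg s' ''j'') = S j" "S j \<subseteq> {..<n}"
        using fr[OF f] ready by (simp_all add: S_def j_def ready_def)
      then have Sj': "S j - {v} \<subseteq> {..<n}" by blast
      have N: "N \<subseteq> {..<n}" using neighbours_subset by (auto simp: N_def)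
      have sub1: "insert (S j - {v}) (D j) \<subseteq> ?U" using sub by blast
      have r': "ready s'" "collected ?x (n + 2 ^ e) (D j) s'" using I by (simp_all add: j_def)
      have le: "120 * (n * (cut_card G A - j)) = 120 * n + 120 * (n * (cut_card G A - Suc j))"
      proof -
        have "cut_card G A - j = Suc (cut_card G A - Suc j)" using j by simp
        then show ?thesis by simp
      qed
      have t': "t' + 120 * (n * (cut_card G A - j)) \<le> t + 40 * n + 120 * (n * cut_card G A)"
        using I by (simp add: j_def)
      show ?thesis
        apply (simp only: wp_Seq wp_SAssign)
        apply (intro conjI)
        subgoal using fr[OF f] Sj v resources space j by (simp add: size j_def)
        apply (rule wp_mono[OF step[OF r'(1) f r'(2)]])
        subgoal using sub1 fr[OF f] Sj by simp
        apply (intro conjI)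
        subgoal for t2 s2 using fr[of s2] sub1 sub U fr[OF f] Sj Sj' N by (simp add: size)
        apply (elim conjE)
        subgoal for t2 s2
          apply (rule wp_mono[OF step[where E = "insert (S j - {v}) (D j)"]])
          subgoal by simp
          subgoal by simp
          subgoal using fr[OF f] Sj by simp
          subgoal using sub fr[of s2] fr[OF f] Sj by simp
          subgoal for t3 s3
          proof -
            assume 2: "t2 \<le> t' + (bcost (set_size M) (Less (IReg ''j'') (IReg ''l'')) + 1) +
                (scost (set_size M) (SDiff (SLoad (Plus (IReg ''p'') (IReg ''j''))) (SSingleton (IReg ''v''))) +
                 set_size M) + 40 * n"
              "sreg s2 ''S'' = sval s' (SDiff (SLoad (Plus (IReg ''p'') (IReg ''j''))) (SSingleton (IReg ''v'')))"
              "ireg s2 ''j'' = ireg s' ''j''"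
              "frame ?x (n + 2 ^ e) (n + 2 ^ (e + 1)) s0 s2"
            assume 3: "t3 \<le> t2 + (scost (set_size M) (SUnion (SReg ''S'') (SReg ''N'')) + set_size M) + 40 * n \<and>
              ready s3 \<and> frame ?x (n + 2 ^ e) (n + 2 ^ (e + 1)) s0 s3 \<and>
              collected ?x (n + 2 ^ e) (insert (sval s2 (SUnion (SReg ''S'') (SReg ''N'')))
                (insert (S j - {v}) (D j))) s3 \<and>
              ireg s3 ''j'' = ireg s2 ''j'' \<and> sreg s3 ''S'' = sval s2 (SUnion (SReg ''S'') (SReg ''N''))"
            have S2: "sreg s2 ''S'' = S j - {v}" using 2(2) fr[OF f] Sj by simp
            have c3: "collected ?x (n + 2 ^ e) (D (Suc j)) s3"
              using 3 S2 fr(6)[OF 2(4)] by (simp add: D_Suc)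
            have j3: "ireg s3 ''j'' = j" using 3 2(3) by (simp add: j_def)
            have "t3 + 4 \<le> t' + 120 * n"
              using 3 2(1) n_pos by (simp add: size)
            then have t3: "t3 + 4 + 120 * (n * (cut_card G A - Suc j)) \<le> t + 40 * n + 120 * (n * cut_card G A)"
              using t' le by linarith
            have r3: "ready s3" "frame ?x (n + 2 ^ e) (n + 2 ^ (e + 1)) s0 s3" using 3 by auto
            have "j < 2 ^ word_size M" "Suc j < 2 ^ word_size M" "Suc 0 < 2 ^ word_size M"
              using j cut resources by linarith+
            then show ?thesis
              using j t3 j3 r3 c3 by (simp add: ready_def frame_def collected_def)
          qed
          done
        done
    qed
  qed
  have rd: "ireg s ''n'' = n" "ireg s ''3'' = 3 * m" "imem s v = 2 ^ v" "imem s (Suc e) = 2 ^ Suc e"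
      "imem s e = 2 ^ e" "smem s v = neighbours G v" "\<And>k. smem s k \<subseteq> {..<n}"
    using ready v e by (simp_all add: ready_def)
  have bnd: "set_encode A < m" "(2::nat) ^ v \<le> m" "2 * (2::nat) ^ e \<le> m" "(2::nat) ^ e \<le> m"
    using set_encode_less[OF A(2)] pow_le[of v] pow_le[of "Suc e"] pow_le[of e] v e by simp_all
  have set: "insert v A \<subseteq> {..<n}" "A \<union> {v} = insert v A" using A' by auto
  show ?thesis
    unfolding list_com_def
    using A v rd bnd resources e e' tab cut set x
    apply (simp add: size neighbours_subset)
    apply (rule wp_state_eq[where s' = s0])
    subgoal unfolding s0_def
      by (rule state.equality) (use A v rd e e' tab set x in \<open>auto simp: fun_eq_iff N_def\<close>)
    apply (rule wp_mono[OF loop])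
    subgoal using n_pos by (simp add: size)
    subgoal for t' s'
    proof (elim conjE, intro conjI)
      assume time: "t' \<le> t + 200 * (n * (cut_card G A + 1))" and r: "ready s'"
        and f: "frame ?x (n + 2 ^ e) (n + 2 ^ (e + 1)) s0 s'"
        and c: "collected ?x (n + 2 ^ e) ?U s'"
      show "t' \<le> t + 200 * (n * (cut_card G A + 1))" by (rule time)
      show "ready s'" by (rule r)
      show "\<forall>r. r \<notin> {''x'', ''l'', ''p'', ''q'', ''c'', ''j'', ''y''} \<longrightarrow> ireg s' r = ireg s r"
        using f by (simp add: frame_def s0_def)
      show "ireg s' ''x'' = ?x" using fr[OF f] by simp
      show c': "ireg s' ''c'' = cut_card G (insert v A)"
        using c bij_betw_same_card[of _ "{..<ireg s' ''c''}" ?U]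
        by (auto simp: collected_def cut_card_def)
      show "sreg s' ''A'' = A" using f A by (simp add: frame_def s0_def)
      show "sreg s' ''W'' = insert v A" using fr[OF f] by simp
      show "bij_betw (\<lambda>k. smem s' (n + 2 ^ (n - card (insert v A)) + k))
          {..<cut_card G (insert v A)} ?U"
        using c c' by (simp add: collected_def e_def)
      show "\<forall>k<4 * m. imem s' k = imem s k" using f by (simp add: frame_def s0_def)
      show "\<forall>k. imem s' k = imem s k \<or> imem s' k = ?x" using f by (simp add: frame_def s0_def)
      show "\<forall>k. n + 2 ^ (n - card A) \<le> k \<longrightarrow> smem s' k = smem s k"
        using fr(8)[OF f] e by simp
    qed
    done
qed

section \<open>Depth-first search: invariant and potential\<close>

definition tab :: "(nat \<Rightarrow> nat) \<Rightarrow> nat set \<Rightarrow> nat" where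
  "tab im A = im (3 * m + set_encode A)"

text \<open>Here \<open>ws\<close> is the stack and \<open>v\<close> the next vertex to be tried.  The penultimate conjunct says that
  an extension of a visited set can only be missing if the visited set is an initial segment of the
  stack whose scan has not passed the extending vertex yet.\<close>

definition search_inv ::
    "nat \<Rightarrow> nat list \<Rightarrow> nat \<Rightarrow> (nat \<Rightarrow> nat) \<Rightarrow> (nat \<Rightarrow> nat set) \<Rightarrow> bool" where
  "search_inv T ws v im sm \<longleftrightarrow> distinct ws \<and> set ws \<subseteq> {..<n} \<and> v \<le> n \<and>
     (\<forall>l<length ws. im (2 * m + l) = ws ! l) \<and>
     (\<forall>w<n. im (m + w) = (if w \<in> set ws then 1 else 0)) \<and>
     (\<forall>l\<le>length ws. tab im (set (take l ws)) \<le> T \<and>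
        bij_betw (\<lambda>k. sm (n + 2 ^ (n - l) + k)) {..<cut_card G (set (take l ws))}
          (union_nbhds G (set (take l ws)))) \<and>
     (\<forall>A\<subseteq>{..<n}. tab im A = 2 * m \<or>
        tab im A = cut_card G A \<and> (cut_card G A \<le> T \<longrightarrow> reach G T A)) \<and>
     (\<forall>A\<subseteq>{..<n}. tab im A \<le> T \<longrightarrow> (\<forall>w<n. w \<notin> A \<longrightarrow> tab im (insert w A) \<noteq> 2 * m \<or>
        (\<exists>l\<le>length ws. A = set (take l ws) \<and> (if l < length ws then ws ! l < w else v \<le> w)))) \<and>
     (\<forall>y<m. \<exists>A\<subseteq>{..<n}. im (4 * m + y) = set_encode A \<and> tab im A \<noteq> 2 * m)"

text \<open>Every set not met so far pays for computing its list, for scanning all its extensions and for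
  removing it from the stack; the sets on the stack keep what remains of the latter two.\<close>

definition potential :: "nat \<Rightarrow> nat list \<Rightarrow> nat \<Rightarrow> (nat \<Rightarrow> nat) \<Rightarrow> nat" where
  "potential T ws v im = 400 * (n * (T + 1)) * card {A. A \<subseteq> {..<n} \<and> tab im A = 2 * m} +
     40 * (\<Sum>w\<leftarrow>ws. n - w) + 40 * (n - v) + 60 * n * length ws"

lemma search_invD:
  assumes "search_inv T ws v im sm"
  shows "distinct ws" "set ws \<subseteq> {..<n}" "v \<le> n"
    and "\<forall>l<length ws. im (2 * m + l) = ws ! l"
    and "\<forall>w<n. im (m + w) = (if w \<in> set ws then 1 else 0)"
    and "\<forall>l\<le>length ws. tab im (set (take l ws)) \<le> T \<and>
        bij_betw (\<lambda>k. sm (n + 2 ^ (n - l) + k)) {..<cut_card G (set (take l ws))}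
          (union_nbhds G (set (take l ws)))"
    and "\<forall>A\<subseteq>{..<n}. tab im A = 2 * m \<or>
        tab im A = cut_card G A \<and> (cut_card G A \<le> T \<longrightarrow> reach G T A)"
    and "\<forall>A\<subseteq>{..<n}. tab im A \<le> T \<longrightarrow> (\<forall>w<n. w \<notin> A \<longrightarrow> tab im (insert w A) \<noteq> 2 * m \<or>
        (\<exists>l\<le>length ws. A = set (take l ws) \<and> (if l < length ws then ws ! l < w else v \<le> w)))"
    and "\<forall>y<m. \<exists>A\<subseteq>{..<n}. im (4 * m + y) = set_encode A \<and> tab im A \<noteq> 2 * m"
  using assms unfolding search_inv_def by - (elim conjE, assumption)+

text \<open>Moving past \<open>v\<close> can only invalidate the excuse for the top set and the
  vertex \<open>v\<close>, and that extension is already in the table or not an extension at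
  all.\<close>

lemma search_inv_next:
  assumes inv: "search_inv T ws v im sm" and v: "v < n"
    and visited: "v \<in> set ws \<or> tab im (insert v (set ws)) \<noteq> 2 * m"
  shows "search_inv T ws (v + 1) im sm" "potential T ws (v + 1) im + 40 = potential T ws v im"
proof -
  have "tab im (insert w A) \<noteq> 2 * m \<or>
      (\<exists>l\<le>length ws. A = set (take l ws) \<and> (if l < length ws then ws ! l < w else v + 1 \<le> w))"
    if A: "A \<subseteq> {..<n}" "tab im A \<le> T" and w: "w < n" "w \<notin> A" for A w
  proof (rule disjCI)
    assume no: "\<not> (\<exists>l\<le>length ws. A = set (take l ws) \<and>
      (if l < length ws then ws ! l < w else v + 1 \<le> w))"
    show "tab im (insert w A) \<noteq> 2 * m"
    proof (rule ccontr)
      assume "\<not> tab im (insert w A) \<noteq> 2 * m"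
      then obtain l where l: "l \<le> length ws" "A = set (take l ws)"
          "if l < length ws then ws ! l < w else v \<le> w"
        using search_invD(8)[OF inv] A w by blast
      with no have "\<not> (if l < length ws then ws ! l < w else v + 1 \<le> w)" by blast
      with l have "l = length ws" "w = v" by (auto split: if_splits)
      then show False using l w visited \<open>\<not> tab im (insert w A) \<noteq> 2 * m\<close> by simp
    qed
  qed
  then show "search_inv T ws (v + 1) im sm"
    using inv v unfolding search_inv_def by simp
  show "potential T ws (v + 1) im + 40 = potential T ws v im"
    using v by (simp add: potential_def)
qed

text \<open>The scan of the top set is complete, so it excuses no missing extension any more. The
  set below resumes after \<open>w\<close>, which agrees with the condition
  \<open>ws ! l < w\<close> it had while inside the stack.\<close>

lemma search_inv_pop:
  assumes inv: "search_inv T (us @ [w]) n im sm"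
    and im: "im' = im(m + w := 0)"
  shows "search_inv T us (w + 1) im' sm" "potential T us (w + 1) im' + 40 + 60 * n = potential T (us @ [w]) n im"
proof -
  have w: "w < n" "w \<notin> set us" and us: "distinct us" "set us \<subseteq> {..<n}"
    using search_invD(1,2)[OF inv] by auto
  have len: "length us < m"
  proof -
    have "length us \<le> card {..<n}"
      using us by (metis card_mono distinct_card finite_lessThan)
    then show ?thesis using n_less by simp
  qed
  have tab': "tab im' A = tab im A" for A
    using w n_less by (simp add: im tab_def)
  note invs = search_invD(4-6)[OF inv] and sound = search_invD(7)[OF inv]
    and mark = search_invD(9)[OF inv]
  have stack: "\<forall>l<length us. im' (2 * m + l) = us ! l"
    using invs(1) w n_less by (auto simp: nth_append im)
  have elem: "\<forall>x<n. im' (m + x) = (if x \<in> set us then 1 else 0)"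
    using invs(2) w by (simp add: im)
  have lists: "\<forall>l\<le>length us. tab im (set (take l us)) \<le> T \<and>
        bij_betw (\<lambda>k. sm (n + 2 ^ (n - l) + k)) {..<cut_card G (set (take l us))}
          (union_nbhds G (set (take l us)))"
  proof (intro allI impI)
    fix l assume "l \<le> length us"
    then show "tab im (set (take l us)) \<le> T \<and>
        bij_betw (\<lambda>k. sm (n + 2 ^ (n - l) + k)) {..<cut_card G (set (take l us))}
          (union_nbhds G (set (take l us)))"
      using invs(3)[rule_format, of l] by simp
  qed
  have mark': "\<forall>y<m. \<exists>A\<subseteq>{..<n}. im' (4 * m + y) = set_encode A \<and> tab im A \<noteq> 2 * m"
    using mark w n_less by (simp add: im)
  have closed: "\<forall>A\<subseteq>{..<n}. tab im A \<le> T \<longrightarrow> (\<forall>x<n. x \<notin> A \<longrightarrow> tab im (insert x A) \<noteq> 2 * m \<or>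
      (\<exists>l\<le>length us. A = set (take l us) \<and> (if l < length us then us ! l < x else w + 1 \<le> x)))"
  proof (intro allI impI)
    fix A x assume A: "A \<subseteq> {..<n}" "tab im A \<le> T" and x: "x < n" "x \<notin> A"
    show "tab im (insert x A) \<noteq> 2 * m \<or>
      (\<exists>l\<le>length us. A = set (take l us) \<and> (if l < length us then us ! l < x else w + 1 \<le> x))"
    proof (rule disj_imp[THEN iffD2, OF impI])
      assume "\<not> tab im (insert x A) \<noteq> 2 * m"
      then obtain l where l: "l \<le> length (us @ [w])" "A = set (take l (us @ [w]))"
          "if l < length (us @ [w]) then (us @ [w]) ! l < x else n \<le> x"
        using search_invD(8)[OF inv] A x by blast
      with x show "\<exists>l\<le>length us. A = set (take l us) \<and>
          (if l < length us then us ! l < x else w + 1 \<le> x)"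
        by (intro exI[of _ l]) (auto simp: nth_append split: if_splits)
    qed
  qed
  show "search_inv T us (w + 1) im' sm"
    unfolding search_inv_def tab' using us w stack elem lists sound closed mark' by auto
  show "potential T us (w + 1) im' + 40 + 60 * n = potential T (us @ [w]) n im"
    using w unfolding potential_def tab' by simp
qed

lemma tab_update:
  assumes "A \<subseteq> {..<n}" "im' (3 * m + set_encode A) = c"
    and "\<And>k. k < 4 * m \<Longrightarrow> k \<noteq> 3 * m + set_encode A \<Longrightarrow> im' k = im k" "B \<subseteq> {..<n}"
  shows "tab im' B = (if B = A then c else tab im B)"
  using assms(1,2) assms(3)[of "3 * m + set_encode B"] set_encode_less[OF assms(4)]
    set_encode_eq_iff[OF assms(4,1)]
  by (auto simp: tab_def)

text \<open>The new table entry is finite because cut values are at most \<open>m\<close>, and it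
  releases the potential that pays for the list. Beyond the threshold nothing is demanded of the
  extensions of \<open>A\<close>; otherwise \<open>A\<close> becomes the top of the stack with its
  scan at 0, so that all its extensions are excused. The increase by \<open>100 * n\<close> prepays
  this scan and the later pop.\<close>

lemma search_inv_generate:
  fixes ws v
  defines "A \<equiv> insert v (set ws)"
  assumes inv: "search_inv T ws v im sm" and v: "v < n" "v \<notin> set ws" and T: "T < 2 * m"
    and new: "tab im A = 2 * m"
    and im': "im' (3 * m + set_encode A) = cut_card G A"
      "\<And>k. k < 4 * m \<Longrightarrow> k \<noteq> 3 * m + set_encode A \<Longrightarrow> im' k = im k"
      "\<And>k. 4 * m \<le> k \<Longrightarrow> im' k = im k \<or> im' k = set_encode A"
    and sm': "\<And>k. n + 2 ^ (n - length ws) \<le> k \<Longrightarrow> sm' k = sm k"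
  shows "potential T ws v im' + 400 * (n * (T + 1)) = potential T ws v im"
    and "tab im' A \<noteq> 2 * m"
    and "T < cut_card G A \<Longrightarrow> search_inv T ws v im' sm'"
    and "cut_card G A \<le> T \<Longrightarrow>
      bij_betw (\<lambda>k. sm' (n + 2 ^ (n - card A) + k)) {..<cut_card G A} (union_nbhds G A) \<Longrightarrow>
      im'' = im'(2 * m + length ws := v, m + v := 1) \<Longrightarrow>
      search_inv T (ws @ [v]) 0 im'' sm' \<and>
      potential T (ws @ [v]) 0 im'' \<le> potential T ws v im' + 100 * n"
proof -
  have ws: "distinct ws" "set ws \<subseteq> {..<n}" using search_invD(1,2)[OF inv] by auto
  have A: "A \<subseteq> {..<n}" using ws v by (auto simp: A_def)
  have len: "length ws < m"
    using ws n_less by (metis card_lessThan card_mono distinct_card finite_lessThan le_less_trans)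
  have cut: "cut_card G A < 2 * m"
  proof -
    have "cut_card G A \<le> 2 ^ (n - card A)"
      using cut_card_le_outside[of G A] A vertices by simp
    also have "\<dots> \<le> m" by (rule pow_le) simp
    finally show ?thesis using n_less by simp
  qed
  have tab': "tab im' B = (if B = A then cut_card G A else tab im B)" if "B \<subseteq> {..<n}" for B
    by (rule tab_update[where im' = im', OF A im'(1) _ that]) (rule im'(2))
  show tab_A: "tab im' A \<noteq> 2 * m" using tab'[OF A] cut by simp
  have take: "set (take l ws) \<subseteq> {..<n}" "set (take l ws) \<noteq> A" for l
    using ws v set_take_subset[of l ws] by (auto simp: A_def)
  have reach_ws: "reach G T (set ws)"
  proof -
    have "tab im (set ws) \<le> T" using search_invD(6)[OF inv] by auto
    then show ?thesis using search_invD(7)[OF inv, rule_format, OF ws(2)] T by auto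
  qed
  have reach: "reach G T A" if "cut_card G A \<le> T"
    using reach.insert[OF reach_ws] v vertices that by (simp add: A_def)
  have stack: "\<forall>l<length ws. im' (2 * m + l) = ws ! l"
    using search_invD(4)[OF inv] len im'(2) by simp
  have elem: "\<forall>w<n. im' (m + w) = (if w \<in> set ws then 1 else 0)"
    using search_invD(5)[OF inv] n_less im'(2) by simp
  have lists: "tab im' (set (take l ws)) \<le> T \<and>
        bij_betw (\<lambda>k. sm' (n + 2 ^ (n - l) + k)) {..<cut_card G (set (take l ws))}
          (union_nbhds G (set (take l ws)))" if l: "l \<le> length ws" for l
  proof -
    have "(2::nat) ^ (n - length ws) \<le> 2 ^ (n - l)"
      using l by (intro power_increasing) auto
    then have "n + 2 ^ (n - length ws) \<le> n + 2 ^ (n - l) + k" for k by simp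
    then have "sm' (n + 2 ^ (n - l) + k) = sm (n + 2 ^ (n - l) + k)" for k
      using sm' by blast
    then show ?thesis using search_invD(6)[OF inv] l take[of l] tab'[of "set (take l ws)"] by simp
  qed
  have sound: "\<forall>B\<subseteq>{..<n}. tab im' B = 2 * m \<or>
      tab im' B = cut_card G B \<and> (cut_card G B \<le> T \<longrightarrow> reach G T B)"
    using search_invD(7)[OF inv] reach tab' by simp
  \<comment> \<open>\<open>B = A\<close> is the only new case, since \<open>A\<close> is the only
    set that gets an entry.\<close>
  have closed: "tab im' (insert w B) \<noteq> 2 * m \<or>
      (\<exists>l\<le>length ws. B = set (take l ws) \<and> (if l < length ws then ws ! l < w else v \<le> w)) \<or> B = A"
    if B: "B \<subseteq> {..<n}" "tab im' B \<le> T" "w < n" "w \<notin> B" for B w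
  proof (rule ccontr)
    assume no: "\<not> ?thesis"
    then have "B \<noteq> A" by blast
    then have "tab im B \<le> T" using B tab' by simp
    then have "tab im (insert w B) \<noteq> 2 * m \<or>
      (\<exists>l\<le>length ws. B = set (take l ws) \<and> (if l < length ws then ws ! l < w else v \<le> w))"
      using search_invD(8)[OF inv] B by blast
    with no tab_A have "tab im' (insert w B) = 2 * m" "tab im (insert w B) \<noteq> 2 * m" by blast+
    then show False using tab'[of "insert w B"] B cut by (auto split: if_splits)
  qed
  have mark: "\<forall>y<m. \<exists>B\<subseteq>{..<n}. im' (4 * m + y) = set_encode B \<and> tab im' B \<noteq> 2 * m"
  proof (intro allI impI)
    fix y assume "y < m"
    then obtain B where B: "B \<subseteq> {..<n}" "im (4 * m + y) = set_encode B" "tab im B \<noteq> 2 * m"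
      using search_invD(9)[OF inv] by blast
    then have "tab im' B \<noteq> 2 * m" using tab' cut by simp
    with B show "\<exists>B\<subseteq>{..<n}. im' (4 * m + y) = set_encode B \<and> tab im' B \<noteq> 2 * m"
      using im'(3)[of "4 * m + y"] A tab_A by (metis le_add1)
  qed
  have "{B. B \<subseteq> {..<n} \<and> tab im B = 2 * m} = insert A {B. B \<subseteq> {..<n} \<and> tab im' B = 2 * m}"
    using tab' new A cut by (auto split: if_splits)
  moreover have "A \<notin> {B. B \<subseteq> {..<n} \<and> tab im' B = 2 * m}" using tab_A by simp
  moreover have "finite {B. B \<subseteq> {..<n} \<and> tab im' B = 2 * m}"
    by (rule finite_subset[of _ "Pow {..<n}"]) auto
  ultimately show "potential T ws v im' + 400 * (n * (T + 1)) = potential T ws v im"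
    by (simp add: potential_def algebra_simps)
  show "search_inv T ws v im' sm'" if "T < cut_card G A"
  proof -
    have "B \<noteq> A" if "B \<subseteq> {..<n}" "tab im' B \<le> T" for B
      using that \<open>T < cut_card G A\<close> tab'[OF A] by auto
    then have "\<forall>B\<subseteq>{..<n}. tab im' B \<le> T \<longrightarrow> (\<forall>w<n. w \<notin> B \<longrightarrow> tab im' (insert w B) \<noteq> 2 * m \<or>
        (\<exists>l\<le>length ws. B = set (take l ws) \<and> (if l < length ws then ws ! l < w else v \<le> w)))"
      using closed by blast
    then show ?thesis
      unfolding search_inv_def using ws v stack elem lists sound mark
      by (intro conjI) (assumption | simp)+
  qed
  assume cut_T: "cut_card G A \<le> T"
    and list: "bij_betw (\<lambda>k. sm' (n + 2 ^ (n - card A) + k)) {..<cut_card G A} (union_nbhds G A)"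
    and im'': "im'' = im'(2 * m + length ws := v, m + v := 1)"
  have tab'': "tab im'' B = tab im' B" for B
    using len v n_less by (simp add: im'' tab_def)
  have card_A: "card A = Suc (length ws)" using ws v by (simp add: A_def distinct_card)
  have "search_inv T (ws @ [v]) 0 im'' sm'"
    unfolding search_inv_def tab''
  proof (intro conjI)
    show "distinct (ws @ [v])" "set (ws @ [v]) \<subseteq> {..<n}" "0 \<le> n" using ws v by auto
    show "\<forall>l<length (ws @ [v]). im'' (2 * m + l) = (ws @ [v]) ! l"
      using stack v n_less by (auto simp: im'' nth_append less_Suc_eq)
    show "\<forall>w<n. im'' (m + w) = (if w \<in> set (ws @ [v]) then 1 else 0)"
      using elem n_less by (auto simp: im'')
    show "\<forall>l\<le>length (ws @ [v]). tab im' (set (take l (ws @ [v]))) \<le> T \<and>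
        bij_betw (\<lambda>k. sm' (n + 2 ^ (n - l) + k)) {..<cut_card G (set (take l (ws @ [v])))}
          (union_nbhds G (set (take l (ws @ [v]))))"
      using lists list cut_T tab'[OF A] card_A by (auto simp: le_Suc_eq A_def)
    show "\<forall>B\<subseteq>{..<n}. tab im' B = 2 * m \<or>
      tab im' B = cut_card G B \<and> (cut_card G B \<le> T \<longrightarrow> reach G T B)" by (rule sound)
    show "\<forall>y<m. \<exists>B\<subseteq>{..<n}. im'' (4 * m + y) = set_encode B \<and> tab im' B \<noteq> 2 * m"
      using mark len v n_less by (simp add: im'')
    show "\<forall>B\<subseteq>{..<n}. tab im' B \<le> T \<longrightarrow> (\<forall>w<n. w \<notin> B \<longrightarrow> tab im' (insert w B) \<noteq> 2 * m \<or>
        (\<exists>l\<le>length (ws @ [v]). B = set (take l (ws @ [v])) \<and>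
          (if l < length (ws @ [v]) then (ws @ [v]) ! l < w else 0 \<le> w)))"
    proof (intro allI impI)
      fix B w assume B: "B \<subseteq> {..<n}" "tab im' B \<le> T" "w < n" "w \<notin> B"
      consider "tab im' (insert w B) \<noteq> 2 * m" | "B = A" | l where "l \<le> length ws"
        "B = set (take l ws)" "if l < length ws then ws ! l < w else v \<le> w"
        using closed[OF B] by blast
      then show "tab im' (insert w B) \<noteq> 2 * m \<or>
        (\<exists>l\<le>length (ws @ [v]). B = set (take l (ws @ [v])) \<and>
          (if l < length (ws @ [v]) then (ws @ [v]) ! l < w else 0 \<le> w))"
      proof cases
        case 2
        then show ?thesis by (intro disjI2 exI[of _ "length (ws @ [v])"]) (auto simp: A_def)
      next
        case (3 l)
        show ?thesis
        \<comment> \<open>Here the missing extension would be \<open>A\<close> itself, which is now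
          in the table. For the former top set and any other \<open>w\<close>,
          \<open>v \<le> w\<close> sharpens to \<open>v < w\<close>, as needed for a set inside the
          stack.\<close>
        proof (cases "l = length ws \<and> w = v")
          case True
          then show ?thesis using 3 tab_A by (simp add: A_def)
        next
          case False
          then show ?thesis
            using 3 by (intro disjI2 exI[of _ l]) (auto simp: nth_append split: if_splits)
        qed
      qed blast
    qed
  qed
  moreover have "potential T (ws @ [v]) 0 im'' \<le> potential T ws v im' + 100 * n"
    using v unfolding potential_def tab'' by simp
  ultimately show "search_inv T (ws @ [v]) 0 im'' sm' \<and>
      potential T (ws @ [v]) 0 im'' \<le> potential T ws v im' + 100 * n" ..
qed

declare set_encode_insert [simp del]

definition searching :: "nat \<Rightarrow> nat list \<Rightarrow> string state \<Rightarrow> bool" where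
  "searching T ws s \<longleftrightarrow> ready s \<and> ireg s ''T'' = T \<and> ireg s ''i'' = length ws \<and>
     sreg s ''A'' = set ws \<and> ireg s ''a'' = set_encode (set ws) \<and>
     search_inv T ws (ireg s ''v'') (imem s) (smem s)"

lemma readyD:
  assumes "ready s"
  shows "ireg s ''n'' = n" "ireg s ''m'' = m" "ireg s ''2'' = 2 * m" "ireg s ''3'' = 3 * m"
    "ireg s ''4'' = 4 * m" "\<And>v. v \<le> n \<Longrightarrow> imem s v = 2 ^ v" "\<And>k. imem s k \<le> 2 * m"
    "\<And>k. imem s k < 2 ^ word_size M"
    "\<And>v. v < n \<Longrightarrow> smem s v = neighbours G v" "\<And>k. smem s k \<subseteq> {..<n}"
  using assms resources by (auto simp: ready_def intro: le_less_trans)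

text \<open>The surplus of 10 pays for one evaluation of the loop guard; \<open>cont\<close> is that
  guard.\<close>

lemma step_correct:
  assumes s: "searching T ws s" and T: "T < 2 * m" and cont: "ws \<noteq> [] \<or> ireg s ''v'' \<noteq> n"
  shows "wp M step_com s t (\<lambda>t' s'. \<exists>ws'. searching T ws' s' \<and>
    t' + potential T ws' (ireg s' ''v'') (imem s') + 10 \<le> t + potential T ws (ireg s ''v'') (imem s))"
proof -
  have ready: "ready s" and regs: "ireg s ''T'' = T" "ireg s ''i'' = length ws"
      "sreg s ''A'' = set ws" "ireg s ''a'' = set_encode (set ws)"
    and inv: "search_inv T ws (ireg s ''v'') (imem s) (smem s)"
    using s by (auto simp: searching_def)
  note rd = readyD[OF ready]
  note ws = search_invD(1-3)[OF inv]
  have enc: "set_encode (set ws) < m" using set_encode_less[OF ws(2)] .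
  have len: "length ws \<le> n" "length ws < m"
    using ws n_less by (metis card_lessThan card_mono distinct_card finite_lessThan, metis card_lessThan card_mono distinct_card finite_lessThan le_less_trans)
  show ?thesis
  proof (cases "ireg s ''v'' = n")
    case True
    with cont obtain us w where us: "ws = us @ [w]" by (metis rev_exhaust)
    have w: "w < n" "w \<notin> set us" using ws us by auto
    have st: "imem s (2 * m + length us) = w"
      using search_invD(4)[OF inv] us by simp
    have enc': "set_encode (set ws) = 2 ^ w + set_encode (set us)"
      using w us by (simp add: set_encode_insert)
    have set': "insert w (set us) - {w} = set us" using w by auto
    have pop: "search_inv T us (w + 1) ((imem s)(m + w := 0)) (smem s)"
      "potential T us (w + 1) ((imem s)(m + w := 0)) + 40 + 60 * n = potential T (us @ [w]) n (imem s)"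
      using search_inv_pop[of T us w "imem s" "smem s"] inv True us by auto
    have ready': "ready (s\<lparr>sreg := X, imem := (imem s)(m + w := 0),
        ireg := (ireg s)(''i'' := i', ''a'' := a', ''v'' := v')\<rparr>)" for X i' a' v'
      using ready n_less by (auto simp: ready_def)
    have us_sub: "set us \<subseteq> {..<n}" using ws us by simp
    show ?thesis
      unfolding step_com_def pop_com_def next_com_def
      using True us rd regs w st enc enc' resources len n_pos set' pop us_sub
      apply (simp add: size)
      apply (rule exI[of _ us])
      apply (simp add: searching_def ready')
      done
  next
    case False
    define v where "v = ireg s ''v''"
    have v: "v < n" using False ws(3) by (simp add: v_def)
    let ?A = "insert v (set ws)"
    have A: "?A \<subseteq> {..<n}" using v ws by auto
    have elem: "imem s (m + v) = (if v \<in> set ws then 1 else 0)"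
      using search_invD(5)[OF inv] v by simp
    have pow: "imem s v = 2 ^ v" "(2::nat) ^ v \<le> m" using rd(6) v pow_le by simp_all
    have enc_A: "set_encode (set ws) + 2 ^ v = set_encode ?A" if "v \<notin> set ws"
      using that by (simp add: set_encode_insert)
    show ?thesis
    proof (cases "v \<in> set ws \<or> tab (imem s) ?A \<noteq> 2 * m")
      case True
      note nxt = search_inv_next[OF inv[folded v_def] v True]
      have ready': "ready (s\<lparr>ireg := (ireg s)(''v'' := Suc v)\<rparr>)"
        using ready by (simp add: ready_def)
      have cond: "v \<in> set ws \<or> imem s (3 * m + (set_encode (set ws) + 2 ^ v)) \<noteq> 2 * m"
        using True enc_A by (auto simp: tab_def)
      show ?thesis
      proof (cases "v \<in> set ws")
        \<comment> \<open>\<open>BAnd\<close> evaluates both operands, so the table address is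
          formed and read even for \<open>v\<close> in the current set. It may then leave the table
          block, but it stays below \<open>5 * m\<close>.\<close>
        case True
        show ?thesis
          unfolding step_com_def next_com_def
          using False True v rd regs elem enc pow resources nxt
          apply (simp add: size v_def[symmetric])
          apply (rule exI[of _ ws], simp add: searching_def ready')
          done
      next
        case new: False
        then have "imem s (3 * m + (set_encode (set ws) + 2 ^ v)) \<noteq> 2 * m" using cond by blast
        then show ?thesis
          unfolding step_com_def next_com_def
          using False new v rd regs elem enc pow resources nxt
          apply (simp add: size v_def[symmetric])
          apply (rule exI[of _ ws], simp add: searching_def ready')
          done
      qed
    next
      case gen: False
      then have v_new: "v \<notin> set ws" "tab (imem s) ?A = 2 * m" by auto
      have cond: "imem s (3 * m + (set_encode (set ws) + 2 ^ v)) = 2 * m"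
        using v_new enc_A by (simp add: tab_def)
      have cut: "imem s (3 * m + set_encode (set ws)) = cut_card G (set ws)" "cut_card G (set ws) \<le> T"
      proof -
        have "tab (imem s) (set ws) \<le> T" using search_invD(6)[OF inv] by auto
        then show "imem s (3 * m + set_encode (set ws)) = cut_card G (set ws)" "cut_card G (set ws) \<le> T"
          using search_invD(7)[OF inv, rule_format, OF ws(2)] T by (auto simp: tab_def)
      qed
      have card: "card (set ws) = length ws" using ws by (simp add: distinct_card)
      have list: "bij_betw (\<lambda>k. smem s (n + 2 ^ (n - card (set ws)) + k)) {..<cut_card G (set ws)}
          (union_nbhds G (set ws))"
        using search_invD(6)[OF inv] card by auto
      have fresh: "\<forall>y<m. imem s (4 * m + y) \<noteq> set_encode ?A"
        using search_invD(9)[OF inv] v_new set_encode_eq_iff[OF _ A] by metis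
      have list_com: "wp M list_com s t1 (\<lambda>t' s'. t' \<le> t1 + 200 * (n * (cut_card G (set ws) + 1)) \<and> ready s' \<and>
         (\<forall>r. r \<notin> {''x'', ''l'', ''p'', ''q'', ''c'', ''j'', ''y''} \<longrightarrow> ireg s' r = ireg s r) \<and>
         ireg s' ''x'' = set_encode ?A \<and> ireg s' ''c'' = cut_card G ?A \<and>
         sreg s' ''A'' = set ws \<and> sreg s' ''W'' = ?A \<and>
         bij_betw (\<lambda>k. smem s' (n + 2 ^ (n - card ?A) + k)) {..<cut_card G ?A} (union_nbhds G ?A) \<and>
         (\<forall>k<4 * m. imem s' k = imem s k) \<and>
         (\<forall>k. imem s' k = imem s k \<or> imem s' k = set_encode ?A) \<and>
         (\<forall>k. n + 2 ^ (n - card (set ws)) \<le> k \<longrightarrow> smem s' k = smem s k))" for t1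
        using ready regs ws v v_new cut list fresh card by (intro list_correct) (simp_all add: v_def)
      have enc_less: "set_encode ?A < m" using set_encode_less[OF A] .
      have cut_A: "cut_card G ?A \<le> m"
      proof -
        have "cut_card G ?A \<le> 2 ^ (n - card ?A)"
          using cut_card_le_outside[of G ?A] A vertices by simp
        also have "\<dots> \<le> m" by (rule pow_le) simp
        finally show ?thesis .
      qed
      have rest: "wp M (IStore (Plus (IReg ''3'') (IReg ''x'')) (IReg ''c'') ;;
           Cond (Less (IReg ''T'') (IReg ''c'')) next_com push_com) s1 t1
         (\<lambda>t' s'. \<exists>ws'. searching T ws' s' \<and>
           t' + potential T ws' (ireg s' ''v'') (imem s') + 10 \<le> t + potential T ws v (imem s))"
        if t1: "t1 \<le> t + 40 + 200 * (n * (cut_card G (set ws) + 1))" and r1: "ready s1"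
          and i1: "\<forall>r. r \<notin> {''x'', ''l'', ''p'', ''q'', ''c'', ''j'', ''y''} \<longrightarrow> ireg s1 r = ireg s r"
          and x1: "ireg s1 ''x'' = set_encode ?A" "ireg s1 ''c'' = cut_card G ?A"
            "sreg s1 ''A'' = set ws" "sreg s1 ''W'' = ?A"
          and l1: "bij_betw (\<lambda>k. smem s1 (n + 2 ^ (n - card ?A) + k)) {..<cut_card G ?A} (union_nbhds G ?A)"
          and m1: "\<forall>k<4 * m. imem s1 k = imem s k"
            "\<forall>k. imem s1 k = imem s k \<or> imem s1 k = set_encode ?A"
          and s1: "\<forall>k. n + 2 ^ (n - card (set ws)) \<le> k \<longrightarrow> smem s1 k = smem s k"
        for t1 s1
      proof -
        let ?im = "(imem s1)(3 * m + set_encode ?A := cut_card G ?A)"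
        note g = search_inv_generate[OF inv[folded v_def] v v_new(1) T v_new(2), where im' = ?im and sm' = "smem s1"]
        have g_prems: "?im (3 * m + set_encode ?A) = cut_card G ?A"
          "\<And>k. k < 4 * m \<Longrightarrow> k \<noteq> 3 * m + set_encode ?A \<Longrightarrow> ?im k = imem s k"
          "\<And>k. 4 * m \<le> k \<Longrightarrow> ?im k = imem s k \<or> ?im k = set_encode ?A"
          "\<And>k. n + 2 ^ (n - length ws) \<le> k \<Longrightarrow> smem s1 k = smem s k"
          using m1 s1 card enc_less by auto
        have g1: "potential T ws v ?im + 400 * (n * (T + 1)) = potential T ws v (imem s)"
          by (rule g(1); fact g_prems)
        have g2: "tab ?im ?A \<noteq> 2 * m"
          by (rule g(2); fact g_prems)
        have regs1: "ireg s1 ''T'' = T" "ireg s1 ''i'' = length ws" "ireg s1 ''v'' = v"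
          "ireg s1 ''a'' = set_encode (set ws)"
          using i1 regs by (simp_all add: v_def)
        have "n * (cut_card G (set ws) + 1) \<le> n * (T + 1)" "n \<le> n * (T + 1)"
          using cut by simp_all
        \<comment> \<open>Of the released \<open>400 * (n * (T + 1))\<close>, at most half pays for
          the list, because the parent has at most \<open>T\<close> unions; the rest covers the push
          with its prepayment.\<close>
        then have time: "t1 + potential T ws v ?im + 160 * n \<le> t + potential T ws v (imem s)"
          using g1 t1 n_pos by linarith
        show ?thesis
        proof (cases "T < cut_card G ?A")
          case True
          have g3: "search_inv T ws v ?im (smem s1)"
            by (rule g(3); fact g_prems True)
          note nxt = search_inv_next[OF g3 v disjI2[OF g2]]
          have ready': "ready (s1\<lparr>imem := ?im, ireg := (ireg s1)(''v'' := Suc v)\<rparr>)"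
            using r1 cut_A n_less by (simp add: ready_def)
          show ?thesis
            unfolding next_com_def
            using True v readyD[OF r1] regs1 x1 enc enc_less pow resources cut_A nxt time T
            apply (simp add: size)
            apply (rule exI[of _ ws], simp add: searching_def ready')
            done
        next
          case False
          let ?im2 = "?im(2 * m + length ws := v, m + v := 1)"
          have le: "cut_card G ?A \<le> T" using False by simp
          have "search_inv T (ws @ [v]) 0 ?im2 (smem s1) \<and>
             potential T (ws @ [v]) 0 ?im2 \<le> potential T ws v ?im + 100 * n"
            by (rule g(4); (fact g_prems | fact le | fact l1 | rule refl))
          then have push: "search_inv T (ws @ [v]) 0 ?im2 (smem s1)"
             "potential T (ws @ [v]) 0 ?im2 \<le> potential T ws v ?im + 100 * n"
            by auto
          have ready': "ready (s1\<lparr>imem := ?im2, sreg := X,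
               ireg := (ireg s1)(''a'' := a', ''i'' := i', ''v'' := v')\<rparr>)" for X a' i' v'
            using r1 cut_A n_less v by (simp add: ready_def)
          show ?thesis
            unfolding push_com_def
            using False v readyD[OF r1] regs1 x1 enc enc_less pow resources cut_A push time T len A
            apply (simp add: size)
            apply (rule exI[of _ "ws @ [v]"], simp add: searching_def ready'[simplified])
            done
        qed
      qed
      show ?thesis
        unfolding step_com_def v_def[symmetric]
        using False v v_new(1) rd regs elem enc pow resources cond
        apply (simp add: size v_def[symmetric])
        apply (rule wp_mono[OF list_com])
        apply (elim conjE)
        apply (rule rest)
        apply simp_all
        done
    qed
  qed
qed

text \<open>Elapsed time plus potential never grows, which gives the running time and termination
  together.\<close>

lemma search_correct:
  assumes s: "searching T ws s" and T: "T < 2 * m"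
  shows "wp M search_com s t (\<lambda>t' s'. t' \<le> t + potential T ws (ireg s ''v'') (imem s) + 10 \<and>
    searching T [] s' \<and> ireg s' ''v'' = n)"
proof -
  let ?B = "t + potential T ws (ireg s ''v'') (imem s)"
  let ?I = "\<lambda>t' s'. \<exists>ws'. searching T ws' s' \<and> t' + potential T ws' (ireg s' ''v'') (imem s') \<le> ?B"
  let ?b = "BNot (BAnd (IEq (IReg ''i'') (Const 0)) (IEq (IReg ''v'') (IReg ''n'')))"
  have fits: "ireg s' ''n'' = n" "ireg s' ''i'' = length ws'" "length ws' \<le> n" "ireg s' ''v'' \<le> n"
    if "searching T ws' s'" for ws' s'
  proof -
    have inv: "search_inv T ws' (ireg s' ''v'') (imem s') (smem s')"
      using that by (simp add: searching_def)
    note ws = search_invD(1-3)[OF inv]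
    show "length ws' \<le> n" using ws by (metis card_lessThan card_mono distinct_card finite_lessThan)
    show "ireg s' ''v'' \<le> n" by (rule ws(3))
    show "ireg s' ''n'' = n" "ireg s' ''i'' = length ws'"
      using that by (auto simp: searching_def ready_def)
  qed
  show ?thesis
    unfolding search_com_def
  proof (rule wp_While[where I = ?I and B = ?B])
    show "?I t s" using s by blast
    fix t' s' assume "?I t' s'"
    then obtain ws' where ws': "searching T ws' s'" "t' + potential T ws' (ireg s' ''v'') (imem s') \<le> ?B"
      by blast
    show "bfits M s' ?b" using fits[OF ws'(1)] resources by simp
    show "t' \<le> ?B" using ws'(2) by simp
    show "wp M step_com s' (t' + (bcost (set_size M) ?b + 1)) ?I" if "bval s' ?b"
    proof (rule wp_mono[OF step_correct[OF ws'(1) T]])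
      show "ws' \<noteq> [] \<or> ireg s' ''v'' \<noteq> n" using that fits[OF ws'(1)] by auto
      fix t2 s2
      assume "\<exists>ws2. searching T ws2 s2 \<and> t2 + potential T ws2 (ireg s2 ''v'') (imem s2) + 10
        \<le> t' + (bcost (set_size M) ?b + 1) + potential T ws' (ireg s' ''v'') (imem s')"
      then obtain ws2 where "searching T ws2 s2" "t2 + potential T ws2 (ireg s2 ''v'') (imem s2) + 10
        \<le> t' + (bcost (set_size M) ?b + 1) + potential T ws' (ireg s' ''v'') (imem s')" by blast
      then show "?I t2 s2" using ws'(2) by (intro exI[of _ ws2]) simp
    qed
    show "t' + (bcost (set_size M) ?b + 1) \<le> ?B + 10 \<and> searching T [] s' \<and> ireg s' ''v'' = n"
      if "\<not> bval s' ?b"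
      using that fits[OF ws'(1)] ws' by simp
  qed
qed

text \<open>A cut value of at most \<open>T\<close> does not by itself make the entry finite: a set
  without an admissible chain to it may remain unmet.\<close>

definition searched :: "nat \<Rightarrow> (nat \<Rightarrow> nat) \<Rightarrow> bool" where
  "searched T im \<longleftrightarrow> (\<forall>A\<subseteq>{..<n}. (reach G T A \<longleftrightarrow> tab im A \<le> T) \<and>
     (tab im A = 2 * m \<or> tab im A = cut_card G A))"

text \<open>With an empty stack and the scan at \<open>n\<close> no excuse is left, so the sets with
  entries at most \<open>T\<close> are closed under admissible extensions; induction along the chain
  does the rest.\<close>

lemma search_inv_exit:
  assumes inv: "search_inv T [] n im sm" and T: "T < 2 * m"
  shows "searched T im"
proof -
  have complete: "tab im A \<le> T" if "reach G T A" for A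
    using that
  proof induction
    case empty
    show ?case using search_invD(6)[OF inv] by simp
  next
    case (insert A v)
    have A: "A \<subseteq> {..<n}" "insert v A \<subseteq> {..<n}" "v < n"
      using reach_subset[OF insert.hyps(1)] insert.hyps(2) vertices by auto
    have "tab im (insert v A) \<noteq> 2 * m"
      using search_invD(8)[OF inv, rule_format, of A v] A insert by auto
    then show ?case
      using search_invD(7)[OF inv, rule_format, OF A(2)] insert.hyps(4) by auto
  qed
  have "(reach G T A \<longleftrightarrow> tab im A \<le> T) \<and> (tab im A = 2 * m \<or> tab im A = cut_card G A)"
    if A: "A \<subseteq> {..<n}" for A
    using complete[of A] search_invD(7)[OF inv, rule_format, OF A] T by auto
  then show ?thesis by (simp add: searched_def)
qed

lemma clear_correct:
  assumes ready: "ready s" and T: "ireg s ''T'' = T" "1 \<le> T" "T < 2 * m"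
    and elem: "\<forall>w<n. imem s (m + w) = 0"
  shows "wp M clear_com s t (\<lambda>t' s'. t' \<le> t + 100 * (n * m) \<and> searching T [] s' \<and>
    ireg s' ''v'' = 0)"
proof -
  let ?I = "\<lambda>t' s'. ireg s' ''j'' \<le> m \<and> t' + 30 * (m - ireg s' ''j'') \<le> t + 2 + 30 * m \<and>
    ready s' \<and> ireg s' ''T'' = T \<and> (\<forall>w<n. imem s' (m + w) = 0) \<and>
    (\<forall>y<ireg s' ''j''. imem s' (3 * m + y) = 2 * m \<and> imem s' (4 * m + y) = 0)"
  have nm: "n \<le> n * m" "m \<le> n * m" using n_pos n_less by simp_all
  have final: "searching T [] (s'\<lparr>ireg := (ireg s')(''a'' := 0, ''i'' := 0, ''v'' := 0), sreg := X,
      imem := (imem s')(3 * m := Suc 0), smem := (smem s')(n + m := {})\<rparr>)"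
    if ready': "ready s'" and T': "ireg s' ''T'' = T" and elem': "\<forall>w<n. imem s' (m + w) = 0"
      and clr: "\<forall>y<m. imem s' (3 * m + y) = 2 * m \<and> imem s' (4 * m + y) = 0"
      and X: "X ''A'' = {}"
    for s' X
  proof -
    let ?im = "(imem s')(3 * m := Suc 0)" and ?sm = "(smem s')(n + m := {})"
    have tab: "tab ?im A = (if A = {} then 1 else 2 * m)" if "A \<subseteq> {..<n}" for A
      using clr set_encode_less[OF that] set_encode_eq_iff[OF that, of "{}"] by (auto simp: tab_def)
    have m2: "2 * m \<noteq> 1" by presburger
    have "search_inv T [] 0 ?im ?sm"
      unfolding search_inv_def
    proof (intro conjI)
      show "\<forall>l\<le>length []. tab ?im (set (take l [])) \<le> T \<and>
        bij_betw (\<lambda>k. ?sm (n + 2 ^ (n - l) + k)) {..<cut_card G (set (take l []))}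
          (union_nbhds G (set (take l [])))"
        using tab[of "{}"] T by (simp add: union_nbhds_empty m_eq[symmetric] bij_betw_def lessThan_Suc)
      show "\<forall>A\<subseteq>{..<n}. tab ?im A = 2 * m \<or>
        tab ?im A = cut_card G A \<and> (cut_card G A \<le> T \<longrightarrow> reach G T A)"
        using tab T by (auto intro: reach.empty)
      show "\<forall>A\<subseteq>{..<n}. tab ?im A \<le> T \<longrightarrow> (\<forall>w<n. w \<notin> A \<longrightarrow> tab ?im (insert w A) \<noteq> 2 * m \<or>
        (\<exists>l\<le>length []. A = set (take l []) \<and> (if l < length [] then [] ! l < w else 0 \<le> w)))"
        using tab T by (auto split: if_splits)
      \<comment> \<open>The cleared mark 0 is also the index of the empty set. This is harmless:
        that set has entry 1 and is never generated again.\<close>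
      show "\<forall>y<m. \<exists>A\<subseteq>{..<n}. ?im (4 * m + y) = set_encode A \<and> tab ?im A \<noteq> 2 * m"
      proof (intro allI impI)
        fix y assume "y < m"
        then show "\<exists>A\<subseteq>{..<n}. ?im (4 * m + y) = set_encode A \<and> tab ?im A \<noteq> 2 * m"
          using clr tab[of "{}"] m2 by (intro exI[of _ "{}"]) simp
      qed
    qed (use elem' n_less in auto)
    moreover have "ready (s'\<lparr>ireg := (ireg s')(''a'' := 0, ''i'' := 0, ''v'' := 0),
        sreg := X, imem := ?im, smem := ?sm\<rparr>)"
      using ready' n_less by (auto simp: ready_def)
    ultimately show ?thesis using T' X by (simp add: searching_def)
  qed
  show ?thesis
    unfolding clear_com_def
    using resources readyD[OF ready]
    apply (simp add: size)
    apply (rule wp_While[where I = ?I and B = "t + 2 + 30 * m"])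
    subgoal using ready T elem by (simp add: ready_def)
    subgoal for t' s' using resources readyD[of s'] by simp
    subgoal by simp
    subgoal premises p for t' s'
    proof -
      have r: "ready s'" and time: "t' + 30 * (m - ireg s' ''j'') \<le> t + 2 + 30 * m"
        using p by simp_all
      have new: "ready (s'\<lparr>imem := (imem s')(3 * m + ireg s' ''j'' := 2 * m, 4 * m + ireg s' ''j'' := 0),
          ireg := (ireg s')(''j'' := Suc (ireg s' ''j''))\<rparr>)"
        using r n_less by (auto simp: ready_def)
      show ?thesis
        using p resources readyD[OF r] new time by (simp add: size less_Suc_eq)
    qed
    subgoal premises p for t' s'
    proof -
      have r: "ready s'" and time: "t' + 30 * (m - ireg s' ''j'') \<le> t + 2 + 30 * m"
        using p by simp_all
      have j: "ireg s' ''j'' = m" using p readyD[OF r] by auto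
      have time': "t' + 4 * n + 20 \<le> t + 100 * (n * m)"
        using time nm resources j by linarith
      note f = final[OF r, of "(sreg s')(''A'' := {})"]
      show ?thesis
        using p resources readyD[OF r] j time' f by (simp add: size)
    qed
    done
qed

lemma potential_start: "potential T [] 0 im \<le> 400 * (n * (T + 1)) * m + 40 * n"
proof -
  have "card {A. A \<subseteq> {..<n} \<and> tab im A = 2 * m} \<le> card (Pow {..<n})"
    by (intro card_mono) auto
  then have "card {A. A \<subseteq> {..<n} \<and> tab im A = 2 * m} \<le> m"
    by (simp add: card_Pow m_eq)
  then show ?thesis by (simp add: potential_def)
qed

section \<open>The dynamic program over the table\<close>

lemma set_encode_full: "set_encode {..<n} = m - 1"
  by (simp add: set_encode_def m_eq mask_eq_sum_exp_nat lessThan_def)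

lemma set_decode_subset: "a < m \<Longrightarrow> set_decode a \<subseteq> {..<n}"
proof
  fix x assume a: "a < m" and "x \<in> set_decode a"
  then have "a div 2 ^ x \<noteq> 0" by (auto simp: set_decode_def intro: ccontr)
  then have "(2::nat) ^ x \<le> a" by (simp add: div_eq_0_iff)
  then have "(2::nat) ^ x < 2 ^ n" using a by (simp add: m_eq)
  then show "x \<in> {..<n}" by (simp add: power_strict_increasing_iff)
qed

text \<open>The register \<open>d\<close> starts at \<open>2 * m\<close>, the code for infinity;
  restricting \<open>k\<close> to values below it keeps this cap invisible.\<close>

lemma min_correct:
  assumes ready: "ready s" and A: "A \<subseteq> {..<n}" "ireg s ''a'' = set_encode A"
  shows "wp M min_com s t (\<lambda>t' s'. t' \<le> t + 100 * n \<and>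
    (\<forall>r. r \<notin> {''d'', ''r'', ''v'', ''y''} \<longrightarrow> ireg s' r = ireg s r) \<and>
    imem s' = imem s \<and> smem s' = smem s \<and> ireg s' ''d'' \<le> 2 * m \<and>
    (\<forall>k<2 * m. ireg s' ''d'' \<le> k \<longleftrightarrow> (\<exists>w\<in>A. tab (imem s) (A - {w}) \<le> k)))"
proof -
  let ?I = "\<lambda>t' s'. ireg s' ''v'' \<le> n \<and> t' + 40 * ireg s' ''v'' \<le> t + 6 + 40 * n \<and>
    (\<forall>r. r \<notin> {''d'', ''r'', ''v'', ''y''} \<longrightarrow> ireg s' r = ireg s r) \<and>
    imem s' = imem s \<and> smem s' = smem s \<and> ireg s' ''d'' \<le> 2 * m \<and>
    ireg s' ''r'' = set_encode (A \<inter> {..<ireg s' ''v''}) \<and>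
    (\<forall>k<2 * m. ireg s' ''d'' \<le> k \<longleftrightarrow>
      (\<exists>w\<in>A. ireg s' ''v'' \<le> w \<and> tab (imem s) (A - {w}) \<le> k))"
  have fin: "finite B" if "B \<subseteq> A" for B using A that by (meson finite_lessThan finite_subset)
  have remove: "set_encode A - 2 ^ v = set_encode (A - {v})" if "v \<in> A" for v
    using that set_encode_insert[OF fin[of "A - {v}"], of v] by (simp add: insert_absorb)
  note rd = readyD[OF ready]
  have encA: "set_encode A < m" using set_encode_less[OF A(1)] .
  show ?thesis
    unfolding min_com_def
    using resources rd A encA
    apply (simp add: size)
    apply (rule wp_While[where I = ?I and B = "t + 6 + 40 * n"])
    subgoal using A rd by (auto simp: Int_absorb2)
    subgoal using resources by auto
    subgoal by simp
    subgoal premises p for t' s'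
    proof -
      define v where "v = ireg s' ''v'' - 1"
      have v': "ireg s' ''v'' = Suc v" "v < n" using p by (auto simp: v_def)
      have fr: "\<And>r. r \<notin> {''d'', ''r'', ''v'', ''y''} \<Longrightarrow> ireg s' r = ireg s r"
        and mem: "imem s' = imem s" "smem s' = smem s" and d: "ireg s' ''d'' \<le> 2 * m"
        and time: "t' + 40 * ireg s' ''v'' \<le> t + 6 + 40 * n"
        and r: "ireg s' ''r'' = set_encode (A \<inter> {..<Suc v})"
        and min: "\<And>k. k < 2 * m \<Longrightarrow> ireg s' ''d'' \<le> k \<longleftrightarrow>
          (\<exists>w\<in>A. Suc v \<le> w \<and> tab (imem s) (A - {w}) \<le> k)"
        using p v' by simp_all
      have pow: "imem s v = 2 ^ v" "(2::nat) ^ v \<le> m" using rd(6) v' pow_le by simp_all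
      \<comment> \<open>The digits below \<open>v\<close> sum to less than \<open>2 ^ v\<close>, so
        comparing \<open>r\<close> with \<open>2 ^ v\<close> decides whether \<open>v\<close>
        belongs to \<open>A\<close>.\<close>
      have rv: "set_encode (A \<inter> {..<v}) < 2 ^ v"
      proof -
        have "set_encode (A \<inter> {..<v}) \<le> set_encode {..<v}"
          by (simp add: set_encode_def sum_mono2)
        also have "\<dots> = 2 ^ v - 1"
          by (simp add: set_encode_def mask_eq_sum_exp_nat lessThan_def)
        finally show ?thesis by (simp add: less_eq_Suc_le[symmetric] Suc_le_eq order.strict_trans1)
      qed
      have regs: "ireg s' ''a'' = set_encode A" "ireg s' ''3'' = 3 * m"
        using fr A rd by simp_all
      show ?thesis
      proof (cases "v \<in> A")
        case False
        then have "A \<inter> {..<Suc v} = A \<inter> {..<v}" by (auto simp: less_Suc_eq)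
        then have r': "ireg s' ''r'' = set_encode (A \<inter> {..<v})" using r by simp
        have min': "ireg s' ''d'' \<le> k \<longleftrightarrow> (\<exists>w\<in>A. v \<le> w \<and> tab (imem s) (A - {w}) \<le> k)"
          if "k < 2 * m" for k
          using min[OF that] False by (metis Suc_le_eq le_neq_implies_less less_imp_le_nat)
        show ?thesis
          using fr mem d time r' min' v' pow rv rd resources regs encA
          by (simp add: size)
      next
        case True
        have "A \<inter> {..<Suc v} = insert v (A \<inter> {..<v})" using True by (auto simp: less_Suc_eq)
        then have r': "ireg s' ''r'' = 2 ^ v + set_encode (A \<inter> {..<v})"
          using r by (simp add: set_encode_insert fin)
        have split: "(\<exists>w\<in>A. v \<le> w \<and> P w) \<longleftrightarrow> P v \<or> (\<exists>w\<in>A. Suc v \<le> w \<and> P w)" for P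
          using True by (metis Suc_le_eq le_eq_less_or_eq)
        define y where "y = imem s (3 * m + set_encode (A - {v}))"
        have min': "(\<exists>w\<in>A. v \<le> w \<and> tab (imem s) (A - {w}) \<le> k) \<longleftrightarrow>
            (if y < ireg s' ''d'' then y else ireg s' ''d'') \<le> k"
          if "k < 2 * m" for k
          unfolding split min[OF that, symmetric] by (auto simp: tab_def y_def)
        have y: "y \<le> 2 * m" "y < 2 ^ word_size M" using rd(7,8) by (simp_all add: y_def)
        have enc: "set_encode (A - {v}) < m" using A by (intro set_encode_less) auto
        have rm: "2 ^ v + set_encode (A \<inter> {..<v}) \<le> m + m" using pow rv by simp
        show ?thesis
          using fr mem d time r' min' v' pow rv rd resources regs encA remove[OF True] y enc True rm
          by (simp add: size y_def[symmetric])
      qed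
    qed
    subgoal premises p for t' s'
      using p n_pos by simp
    done
qed

text \<open>Agreement of \<open>x\<close> with the bottleneck value of \<open>A\<close>, truncated
  at \<open>T\<close>: the search explores only chains within the threshold, so larger values carry
  no information.\<close>

definition settled :: "nat \<Rightarrow> nat \<Rightarrow> nat set \<Rightarrow> bool" where
  "settled T x A \<longleftrightarrow> (\<forall>k\<le>T. x \<le> k \<longleftrightarrow> reach G k A)"

text \<open>This is \<open>reach_iff\<close> with the table entry in place of the cut value. The
  exchange is sound because the entry is the cut value if \<open>A\<close> is reached at
  \<open>T\<close>, and otherwise exceeds \<open>T\<close>, which makes both sides false.\<close>

lemma settled_step:
  assumes im: "searched T im" and T: "T < 2 * m" and A: "A \<subseteq> {..<n}" "A \<noteq> {}"
    and settled: "\<And>w. w \<in> A \<Longrightarrow> settled T (tab im' (A - {w})) (A - {w})"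
    and d: "\<forall>k<2 * m. d \<le> k \<longleftrightarrow> (\<exists>w\<in>A. tab im' (A - {w}) \<le> k)"
  shows "settled T (max (tab im A) d) A"
  unfolding settled_def
proof (intro allI impI)
  fix k assume k: "k \<le> T"
  have "d \<le> k \<longleftrightarrow> (\<exists>w\<in>A. reach G k (A - {w}))"
    using d settled k T by (auto simp: settled_def)
  moreover have "tab im A = cut_card G A" if "reach G T A"
    using im[unfolded searched_def, rule_format, OF A(1)] that T by auto
  moreover have "tab im A \<le> k \<Longrightarrow> reach G T A" "reach G k A \<Longrightarrow> reach G T A"
    using im[unfolded searched_def, rule_format, OF A(1)] k reach_mono[of G k A T] by auto
  ultimately show "max (tab im A) d \<le> k \<longleftrightarrow> reach G k A"
    using reach_iff[of A G k] A vertices by (metis max.bounded_iff)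
qed

text \<open>Entries below the current index are settled, all others are still those of the search.
  The empty set needs no step: its entry 1 is already settled.\<close>

lemma dp_correct:
  assumes ready: "ready s" and im: "searched T (imem s)" and T: "1 \<le> T" "T < 2 * m"
  shows "wp M dp_com s t (\<lambda>t' s'. t' \<le> t + 200 * (n * m) \<and> ready s' \<and>
    settled T (tab (imem s') {..<n}) {..<n})"
proof -
  let ?I = "\<lambda>t' s'. 1 \<le> ireg s' ''a'' \<and> ireg s' ''a'' \<le> m \<and>
    t' + 150 * (n * (m - ireg s' ''a'')) \<le> t + 2 + 150 * (n * m) \<and> ready s' \<and>
    (\<forall>A\<subseteq>{..<n}. set_encode A < ireg s' ''a'' \<longrightarrow> settled T (tab (imem s') A) A) \<and>
    (\<forall>A\<subseteq>{..<n}. ireg s' ''a'' \<le> set_encode A \<longrightarrow> tab (imem s') A = tab (imem s) A)"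
  note rd = readyD[OF ready]
  show ?thesis
    unfolding dp_com_def
    using resources rd
    apply (simp add: size)
    apply (rule wp_While[where I = ?I and B = "t + 2 + 150 * (n * m)"])
    subgoal premises p
    proof -
      have r: "ready (s\<lparr>ireg := (ireg s)(''a'' := Suc 0)\<rparr>)"
        using ready by (simp add: ready_def)
      have "settled T (tab (imem s) A) A" if "A \<subseteq> {..<n}" "set_encode A = 0" for A
      proof -
        have "A = {}" using that set_encode_eq_iff[of A "{}"] by simp
        moreover have "tab (imem s) {} = 1"
          using im T reach.empty[of T G] by (auto simp: searched_def)
        moreover have "reach G k {} \<longleftrightarrow> 1 \<le> k" for k
          using reach.empty[of k G] reach_pos[of G k "{}"] by blast
        ultimately show ?thesis by (simp add: settled_def)
      qed
      moreover have "n * (m - 1) \<le> n * m" by simp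
      ultimately show ?thesis using r n_less by (simp add: less_Suc_eq)
    qed
    subgoal for t' s' using resources readyD[of s'] by simp
    subgoal by simp
    subgoal premises p for t' s'
    proof -
      have r: "ready s'" using p by simp
      have a: "1 \<le> ireg s' ''a''" "ireg s' ''a'' < m" using p readyD[OF r] by auto
      have time: "t' + 150 * (n * (m - ireg s' ''a'')) \<le> t + 2 + 150 * (n * m)"
        and done1: "\<And>A. A \<subseteq> {..<n} \<Longrightarrow> set_encode A < ireg s' ''a'' \<Longrightarrow> settled T (tab (imem s') A) A"
        and rest: "\<And>A. A \<subseteq> {..<n} \<Longrightarrow> ireg s' ''a'' \<le> set_encode A \<Longrightarrow> tab (imem s') A = tab (imem s) A"
        using p by auto
      define A where "A = set_decode (ireg s' ''a'')"
      have A: "A \<subseteq> {..<n}" "set_encode A = ireg s' ''a''"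
        using set_decode_subset[OF a(2)] by (simp_all add: A_def)
      then have A_ne: "A \<noteq> {}" using a(1) by auto
      have less: "set_encode (A - {w}) < set_encode A" if "w \<in> A" for w
      proof -
        have "set_encode A = 2 ^ w + set_encode (A - {w})"
          using set_encode_insert[of "A - {w}" w] that A(1) finite_subset[OF A(1)]
          by (simp add: insert_absorb)
        then show ?thesis by simp
      qed
      have set_w: "settled T (tab (imem s') (A - {w})) (A - {w})" if "w \<in> A" for w
        using done1[of "A - {w}"] less[OF that] A by (auto simp del: set_decode_inverse)
      have tabA: "tab (imem s') A = tab (imem s) A" using rest[OF A(1)] A(2) by simp
      have step: "wp M (Cond (Less (ILoad (Plus (IReg ''3'') (IReg ''a''))) (IReg ''d''))
            (IStore (Plus (IReg ''3'') (IReg ''a'')) (IReg ''d'')) Skip ;;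
          IAssign ''a'' (Plus (IReg ''a'') (Const 1))) s2 t2 ?I"
        if t2: "t2 \<le> t' + 4 + 100 * n"
          and regs: "\<forall>r. r \<notin> {''d'', ''r'', ''v'', ''y''} \<longrightarrow> ireg s2 r = ireg s' r"
          and mem: "imem s2 = imem s'" "smem s2 = smem s'" and d: "ireg s2 ''d'' \<le> 2 * m"
          and min: "\<forall>k<2 * m. ireg s2 ''d'' \<le> k \<longleftrightarrow> (\<exists>w\<in>A. tab (imem s') (A - {w}) \<le> k)"
        for t2 s2
      proof -
        let ?a = "ireg s' ''a''" and ?d = "ireg s2 ''d''"
        have new: "settled T (max (tab (imem s') A) ?d) A"
          unfolding tabA by (rule settled_step[OF im T(2) A(1) A_ne set_w min])
        \<comment> \<open>The table after this step, whether or not the conditional stores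
          anything.\<close>
        let ?im = "(imem s')(3 * m + ?a := max (tab (imem s') A) ?d)"
        have tab_im: "tab ?im B = (if B = A then max (tab (imem s') A) ?d else tab (imem s') B)"
          if "B \<subseteq> {..<n}" for B
          using set_encode_eq_iff[OF that A(1)] A(2) by (auto simp: tab_def)
        have i1: "\<forall>B\<subseteq>{..<n}. set_encode B < Suc ?a \<longrightarrow> settled T (tab ?im B) B"
        proof (intro allI impI)
          fix B assume B: "B \<subseteq> {..<n}" "set_encode B < Suc ?a"
          show "settled T (tab ?im B) B"
          proof (cases "B = A")
            case True
            then show ?thesis using new tab_im[OF B(1)] by simp
          next
            case False
            then have "set_encode B < ?a" using B set_encode_eq_iff[OF B(1) A(1)] A(2) by simp
            then show ?thesis using done1[OF B(1)] tab_im[OF B(1)] False by simp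
          qed
        qed
        have i2: "\<forall>B\<subseteq>{..<n}. Suc ?a \<le> set_encode B \<longrightarrow> tab ?im B = tab (imem s) B"
          using tab_im rest A(2) by auto
        have le: "150 * (n * (m - ?a)) = 150 * n + 150 * (n * (m - Suc ?a))"
        proof -
          have "m - ?a = Suc (m - Suc ?a)" using a by simp
          then show ?thesis by simp
        qed
        have r2: "ready s2" using r regs mem by (simp add: ready_def)
        have mx: "max (tab (imem s') A) ?d \<le> 2 * m" using d readyD(7)[OF r] by (simp add: tab_def)
        have r3: "ready (s2\<lparr>imem := ?im, ireg := (ireg s2)(''a'' := Suc ?a)\<rparr>)"
          using r2 mem mx n_less by (auto simp: ready_def)
        have ta: "tab (imem s') A = imem s' (3 * m + ?a)" using A(2) by (simp add: tab_def)
        have regs2: "ireg s2 ''a'' = ?a" using regs by simp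
        have t3: "t2 + 20 + 150 * (n * (m - Suc ?a)) \<le> t + 2 + 150 * (n * m)"
          using time t2 le n_pos by linarith
        show ?thesis
        proof (cases "imem s' (3 * m + ?a) < ?d")
          case True
          then have im_eq: "?im = (imem s')(3 * m + ?a := ?d)" using ta by simp
          show ?thesis
            using True readyD[OF r2] regs2 mem d a resources t3 i1[unfolded im_eq] i2[unfolded im_eq]
              r3[unfolded im_eq]
            by (simp add: size)
        next
          case False
          then have im_eq: "?im = imem s'" using ta by (simp add: fun_upd_idem)
          have "ready (s2\<lparr>ireg := (ireg s2)(''a'' := Suc ?a)\<rparr>)"
            using r2 by (simp add: ready_def)
          then show ?thesis
            using False readyD[OF r2] regs2 mem d a resources t3 i1[unfolded im_eq] i2[unfolded im_eq]
            by (simp add: size)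
        qed
      qed
      show ?thesis
        unfolding wp_Seq[of _ min_com]
        apply (rule wp_mono[OF min_correct[OF r A(1) A(2)[symmetric]]])
        apply (rule step)
        apply (simp_all add: size)
        done
    qed
    subgoal premises p for t' s'
    proof -
      have r: "ready s'" and time: "t' + 150 * (n * (m - ireg s' ''a'')) \<le> t + 2 + 150 * (n * m)"
        using p by simp_all
      have a: "ireg s' ''a'' = m" using p readyD[OF r] by auto
      have "m \<le> n * m" using n_pos by simp
      then have "t' + 4 \<le> t + 200 * (n * m)" using time resources by linarith
      then show ?thesis using p a set_encode_less[of "{..<n}"] by (simp add: size)
    qed
    done
qed

section \<open>Threshold doubling and total cost\<close>

abbreviation width :: nat where
  "width \<equiv> bottleneck G {..<n}"

lemma width_bounds: "1 \<le> width" "width \<le> m"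
  using bottleneck_pos[of G "{..<n}"] bottleneck_le_pow[of G "{..<n}"] vertices by (simp_all add: m_eq)

lemma width_le_iff: "width \<le> k \<longleftrightarrow> reach G k {..<n}"
  using bottleneck_le_iff[of G "{..<n}" k] vertices by simp

lemma last_cell: "4 * m - Suc 0 < 2 ^ word_size M" "4 * m - Suc 0 < icells M"
  using resources by linarith+

text \<open>The initial potential, at most \<open>400 * (n * (T + 1)) * m + 40 * n\<close>,
  dominates; \<open>T + 1 \<le> 2 * T\<close> brings its leading term into the form used here. The
  characteristic function is zero again since the search ends with an empty stack.\<close>

lemma round_correct:
  assumes ready: "ready s" and T: "ireg s ''T'' = T" "1 \<le> T" "T < 2 * m"
    and elem: "\<forall>w<n. imem s (m + w) = 0"
  shows "wp M (clear_com ;; search_com ;; read_com) s t (\<lambda>t' s'.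
    t' \<le> t + 1200 * (n * m * T) \<and> ready s' \<and> ireg s' ''T'' = T \<and>
    (\<forall>w<n. imem s' (m + w) = 0) \<and> searched T (imem s') \<and>
    ireg s' ''out'' = tab (imem s') {..<n})"
proof -
  have nm: "n \<le> n * m * T" "n * m \<le> n * m * T" "1 \<le> n * m * T"
    using n_pos n_less T(2) by simp_all
  have nmT: "400 * (n * (T + 1)) * m \<le> 800 * (n * m * T)"
  proof -
    have "n * m * (T + 1) \<le> n * m * (2 * T)" using T(2) by (intro mult_le_mono2) simp
    then show ?thesis by (simp add: algebra_simps)
  qed
  show ?thesis
    unfolding wp_Seq
  proof (rule wp_mono[OF clear_correct[OF ready T elem]])
    fix t1 s1
    assume 1: "t1 \<le> t + 100 * (n * m) \<and> searching T [] s1 \<and> ireg s1 ''v'' = 0"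
    then have s1: "searching T [] s1" by simp
    show "wp M search_com s1 t1 (\<lambda>t' s'. wp M read_com s' t' (\<lambda>t' s'.
      t' \<le> t + 1200 * (n * m * T) \<and> ready s' \<and> ireg s' ''T'' = T \<and>
      (\<forall>w<n. imem s' (m + w) = 0) \<and> searched T (imem s') \<and>
      ireg s' ''out'' = tab (imem s') {..<n}))"
    proof (rule wp_mono[OF search_correct[OF s1 T(3)]])
      fix t2 s2
      assume 2: "t2 \<le> t1 + potential T [] (ireg s1 ''v'') (imem s1) + 10 \<and>
        searching T [] s2 \<and> ireg s2 ''v'' = n"
      then have inv: "search_inv T [] n (imem s2) (smem s2)" and r: "ready s2"
        and T2: "ireg s2 ''T'' = T"
        by (auto simp: searching_def)
      have elem2: "\<forall>w<n. imem s2 (m + w) = 0" using search_invD(5)[OF inv] by simp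
      have "ireg s1 ''v'' = 0" using 1 by simp
      then have "potential T [] (ireg s1 ''v'') (imem s1) \<le> 400 * (n * (T + 1)) * m + 40 * n"
        using potential_start[of T "imem s1"] by simp
      then have "t2 \<le> t1 + 800 * (n * m * T) + 40 * n + 10"
        using conjunct1[OF 2] nmT by linarith
      then have time: "t2 + 20 \<le> t + 1200 * (n * m * T)"
        using 1 nm by linarith
      have r': "ready (s2\<lparr>ireg := (ireg s2)(''out'' := k)\<rparr>)" for k
        using r by (simp add: ready_def)
      show "wp M read_com s2 t2 (\<lambda>t' s'.
        t' \<le> t + 1200 * (n * m * T) \<and> ready s' \<and> ireg s' ''T'' = T \<and>
        (\<forall>w<n. imem s' (m + w) = 0) \<and> searched T (imem s') \<and>
        ireg s' ''out'' = tab (imem s') {..<n})"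
        unfolding read_com_def
        using readyD[OF r] resources last_cell time T2 elem2 search_inv_exit[OF inv T(3)] r'
        by (simp add: tab_def set_encode_full)
    qed
  qed
qed

text \<open>The geometric sum is hidden in the invariant that the elapsed time is linear in the
  current threshold. A round at \<open>2 * T + 1\<close> costs at most
  \<open>1200 * (n * m * (2 * T + 1))\<close>, and the time before it is about as large, so the
  coefficient 2400 reproduces itself. A round starts only with \<open>T < width\<close>, hence
  \<open>T < 2 * width\<close> throughout.\<close>

lemma lbw_com_correct:
  "wp M lbw_com (input G n) 0 (\<lambda>t s. t \<le> 6000 * (n * m * width) \<and> ireg s ''out'' = width)"
proof -
  let ?X = "n * m"
  let ?I = "\<lambda>t s. ready s \<and> (\<forall>w<n. imem s (m + w) = 0) \<and> ireg s ''out'' \<le> 2 * m \<and>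
    ireg s ''T'' < 2 * width \<and>
    (ireg s ''T'' < ireg s ''out'' \<longrightarrow> ireg s ''T'' < width) \<and>
    (ireg s ''out'' \<le> ireg s ''T'' \<longrightarrow> 1 \<le> ireg s ''T'' \<and> width \<le> ireg s ''T'' \<and>
      searched (ireg s ''T'') (imem s)) \<and>
    t \<le> 110 * ?X + 2400 * (?X * ireg s ''T'')"
  have X: "n \<le> ?X" "1 \<le> ?X" "?X \<le> ?X * width" using n_pos n_less width_bounds by simp_all
  note w = width_bounds
  show ?thesis
    unfolding lbw_com_def wp_Seq[of _ init_com]
  proof (rule wp_mono[OF init_correct])
    fix t1 s1
    assume 1: "t1 \<le> 0 + 100 * n \<and> ready s1 \<and> (\<forall>v<n. imem s1 (m + v) = 0)"
    then have r1: "ready s1" by simp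
    have r1': "ready (s1\<lparr>ireg := (ireg s1)(''out'' := Suc 0, ''T'' := 0)\<rparr>)"
      using r1 by (simp add: ready_def)
    have t1: "t1 + 4 \<le> 110 * ?X" using 1 X n_pos by linarith
    show "wp M (IAssign ''out'' (Const 1) ;; IAssign ''T'' (Const 0) ;;
      While (Less (IReg ''T'') (IReg ''out''))
        (IAssign ''T'' (Plus (Plus (IReg ''T'') (IReg ''T'')) (Const 1)) ;;
         clear_com ;; search_com ;; read_com) ;;
      dp_com ;; read_com) s1 t1
      (\<lambda>t s. t \<le> 6000 * (n * m * width) \<and> ireg s ''out'' = width)"
      using resources
      apply simp
      apply (rule wp_While[where I = ?I and B = "110 * ?X + 4800 * (?X * width)"])
      subgoal using 1 r1' t1 w n_less by simp
      subgoal for t s using w resources by simp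
      subgoal premises p for t s
      proof -
        have "?X * ireg s ''T'' \<le> ?X * (2 * width)" using p by (intro mult_le_mono2) simp
        then have "?X * ireg s ''T'' \<le> 2 * (?X * width)" by (simp only: mult.left_commute)
        moreover have "t \<le> 110 * ?X + 2400 * (?X * ireg s ''T'')" using p by blast
        ultimately show ?thesis by linarith
      qed
      subgoal premises p for t s
      proof -
        define T where "T = ireg s ''T''"
        have Tw: "T < width" and r: "ready s" and time: "t \<le> 110 * ?X + 2400 * (?X * T)"
          and elem: "\<forall>w<n. imem s (m + w) = 0"
          using p by (auto simp: T_def)
        let ?s = "s\<lparr>ireg := (ireg s)(''T'' := 2 * T + 1)\<rparr>"
        have r': "ready ?s" using r by (simp add: ready_def)
        have "wp M (clear_com ;; search_com ;; read_com) ?s t2 ?I" if t2: "t2 \<le> t + 20" for t2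
        proof (rule wp_mono[OF round_correct[OF r', where T = "2 * T + 1"]])
          show "ireg ?s ''T'' = 2 * T + 1" "1 \<le> 2 * T + 1" by simp_all
          show "2 * T + 1 < 2 * m" using Tw w by simp
          show "\<forall>w<n. imem ?s (m + w) = 0" using elem by simp
          fix t3 s3
          assume 3: "t3 \<le> t2 + 1200 * (n * m * (2 * T + 1)) \<and> ready s3 \<and> ireg s3 ''T'' = 2 * T + 1 \<and>
            (\<forall>w<n. imem s3 (m + w) = 0) \<and> searched (2 * T + 1) (imem s3) \<and>
            ireg s3 ''out'' = tab (imem s3) {..<n}"
          have "width \<le> 2 * T + 1 \<longleftrightarrow> ireg s3 ''out'' \<le> 2 * T + 1"
            using 3 unfolding width_le_iff searched_def by auto
          moreover have "ireg s3 ''out'' \<le> 2 * m" using 3 readyD(7)[of s3] by (simp add: tab_def)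
          moreover have "t3 \<le> 110 * ?X + 2400 * (?X * (2 * T + 1))"
          proof -
            have "t3 \<le> 110 * ?X + 2400 * (?X * T) + 20 + 1200 * (?X * (2 * T + 1))"
              using 3 t2 time by linarith
            moreover have "?X * (2 * T + 1) = 2 * (?X * T) + ?X" by simp
            ultimately show ?thesis using X by linarith
          qed
          ultimately show "?I t3 s3" using 3 Tw by auto
        qed
        note round = this
        have small: "T + T + 1 < 2 ^ word_size M" "T < 2 ^ word_size M" "(1::nat) < 2 ^ word_size M"
          using Tw w resources by linarith+
        show ?thesis
          unfolding wp_Seq[of _ "IAssign _ _"] wp_IAssign
          using small
          apply (intro conjI)
           apply (simp add: T_def)
          apply (rule wp_state_eq[where s' = ?s])
           apply (simp add: T_def mult_2)
          apply (rule round)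
          apply simp
          done
      qed
      subgoal premises p for t s
      proof -
        define T where "T = ireg s ''T''"
        have T: "1 \<le> T" "width \<le> T" "T < 2 * m" and r: "ready s" and se: "searched T (imem s)"
          and time: "t \<le> 110 * ?X + 2400 * (?X * T)"
          using p w by (auto simp: T_def)
        have "?X * T \<le> ?X * (2 * width)" using p by (intro mult_le_mono2) (simp add: T_def)
        then have XT: "?X * T \<le> 2 * (?X * width)" by (simp only: mult.left_commute)
        have time2: "t + (bcost (set_size M) (Less (IReg ''T'') (IReg ''out'')) + 1) + 200 * ?X + 20 \<le> 6000 * (?X * width)"
        proof -
          have "bcost (set_size M) (Less (IReg ''T'') (IReg ''out'')) = 3" by simp
          then show ?thesis using time XT X by linarith
        qed
        show ?thesis
          unfolding wp_Seq
        proof (rule wp_mono[OF dp_correct[OF r se T(1,3)]])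
          fix t4 s4
          assume 4: "t4 \<le> t + (bcost (set_size M) (Less (IReg ''T'') (IReg ''out'')) + 1) + 200 * (n * m) \<and>
            ready s4 \<and> settled T (tab (imem s4) {..<n}) {..<n}"
          then have r4: "ready s4" by simp
          \<comment> \<open>As \<open>width \<le> T\<close>, knowledge up to \<open>T\<close>
            suffices: \<open>k = width\<close> bounds the entry from above, and then
            \<open>k\<close> equal to the entry gives the converse.\<close>
          have "tab (imem s4) {..<n} \<le> k \<longleftrightarrow> width \<le> k" if "k \<le> T" for k
            using 4 that unfolding settled_def width_le_iff by blast
          then have "tab (imem s4) {..<n} = width" using T(2) by (metis le_antisym le_refl le_trans)
          moreover have time4: "t4 + 20 \<le> 6000 * (n * m * width)"
            using conjunct1[OF 4] time2 by linarith
          moreover have width_word: "width < 2 ^ word_size M" using w resources by linarith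
          ultimately show "wp M read_com s4 t4 (\<lambda>t s. t \<le> 6000 * (n * m * width) \<and> ireg s ''out'' = width)"
            unfolding read_com_def
            using readyD[OF r4] resources last_cell time4 width_word
            by (simp add: tab_def set_encode_full)
        qed
      qed
      done
  qed
qed

end

theorem theorem2:
  shows "\<exists>(c :: string com) (C :: real).
    \<forall>(G :: nat pair_pre_digraph) (n :: nat).
      pair_graph G \<and> pverts G = {..<n} \<and> 0 < n \<longrightarrow>
      (\<exists>M t s.
         set_size M = n \<and> real (word_size M) \<le> C * real n \<and>
         exec M c (input G n) t s \<and> outputs_log s (lbw G) \<and>
         real t \<le> C * (real n * 2 powr (real n + lbw G)) \<and>
         real (space M c) \<le> C * (real n * 2 ^ n))"
proof (rule exI[of _ lbw_com], rule exI[of _ "real (6000 + 6 * card (vars lbw_com))"], intro allI impI)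
  let ?V = "card (vars lbw_com)"
  \<comment> \<open>The 6000 comes from the time bound; \<open>6 * ?V\<close> pays for the
    registers, each name standing for a word of \<open>5 * n\<close> bits and a bitset of
    \<open>n\<close> bits.\<close>
  let ?C = "real (6000 + 6 * ?V)"
  fix G :: "nat pair_pre_digraph" and n :: nat
  assume G: "pair_graph G \<and> pverts G = {..<n} \<and> 0 < n"
  define m :: nat where "m = 2 ^ n"
  \<comment> \<open>Words of \<open>5 * n\<close> bits suffice even for \<open>n = 1\<close>, where
    \<open>8 * m\<close> is 16 and \<open>2 ^ (5 * n)\<close> is 32.\<close>
  define M where "M = \<lparr>set_size = n, word_size = 5 * n, icells = 5 * m, scells = n + 2 * m\<rparr>"
  have "8 * m < 2 ^ (5 * n)"
  proof -
    have "(2::nat) ^ 4 \<le> 2 ^ (4 * n)" using G by (intro power_increasing) auto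
    then have "8 * m < 2 ^ (4 * n) * m" by (intro mult_less_mono1) (auto simp: m_def)
    also have "\<dots> = 2 ^ (5 * n)" by (simp add: m_def power_add[symmetric])
    finally show ?thesis .
  qed
  then interpret lbw_run G n m M
    using G by (auto simp: lbw_run_def lbw_run_axioms_def M_def m_def)
  obtain t s where run: "exec M lbw_com (input G n) t s" "t \<le> 6000 * (n * m * width)"
      "ireg s ''out'' = width"
    using lbw_com_correct by (auto simp: wp_def)
  have lbw: "lbw G = log 2 (real width)"
    using lbw_eq_log_bottleneck vertices n_pos by auto
  have pow: "2 powr (real n + lbw G) = real m * real width"
    using width_bounds by (simp add: lbw powr_add powr_realpow m_def)
  have space: "space M lbw_com \<le> (28 + 6 * ?V) * (n * m)"
  proof -
    have "space M lbw_com = 27 * (n * m) + n * n + 6 * (n * ?V)"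
      by (simp add: space_def M_def algebra_simps)
    moreover have "n * n \<le> n * m" using n_less by simp
    moreover have "n * ?V \<le> n * m * ?V" using n_less by simp
    moreover have "(28 + 6 * ?V) * (n * m) = 28 * (n * m) + 6 * (n * m * ?V)"
      by (simp add: algebra_simps)
    ultimately show ?thesis by linarith
  qed
  show "\<exists>M t s. set_size M = n \<and> real (word_size M) \<le> ?C * real n \<and>
      exec M lbw_com (input G n) t s \<and> outputs_log s (lbw G) \<and>
      real t \<le> ?C * (real n * 2 powr (real n + lbw G)) \<and>
      real (space M lbw_com) \<le> ?C * (real n * 2 ^ n)"
  proof (intro exI conjI)
    show "set_size M = n" by (rule size)
    show "exec M lbw_com (input G n) t s" by (rule run(1))
    show "outputs_log s (lbw G)" using run(3) width_bounds by (simp add: outputs_log_def lbw)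
    have "5 * n \<le> (6000 + 6 * ?V) * n" by (intro mult_le_mono1) simp
    then show "real (word_size M) \<le> ?C * real n"
      unfolding M_def of_nat_mult[symmetric] of_nat_le_iff by simp
    have "t \<le> (6000 + 6 * ?V) * (n * (m * width))"
      using run(2) by (rule order_trans) (simp add: mult.assoc)
    then show "real t \<le> ?C * (real n * 2 powr (real n + lbw G))"
      unfolding pow of_nat_mult[symmetric] of_nat_le_iff .
    have "space M lbw_com \<le> (6000 + 6 * ?V) * (n * m)"
      using space by (rule order_trans) (intro mult_le_mono1, simp)
    then have "real (space M lbw_com) \<le> ?C * (real n * real m)"
      unfolding of_nat_mult[symmetric] of_nat_le_iff .
    then show "real (space M lbw_com) \<le> ?C * (real n * 2 ^ n)" by (simp add: m_def)
  qed
qed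

end
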